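(* Let $n\ge 2$ and consider the geometric $R$-matrix $R:\mathbb X_{n-1}\times\mathbb X_{n-1}\to\mathbb X_{n-1}\times\mathbb X_{n-1}$ and the map $\Theta R=(\Theta_{n-1}^{-1}\times\Theta_{n-1}^{-1})\circ R\circ(\Theta_{n-1}\times\Theta_{n-1}):\mathbb T_1\times\mathbb T_1\to\mathbb T_1\times\mathbb T_1$. In the coordinates $x_j=X_{1j}/X_{1,j-1}$ on the first factor and $y_j=Y_{1j}/Y_{1,j-1}$ on the second factor ($1\le j\le n$), and the analogous coordinates $y'_j$, $x'_j$ on the first and second factors of the target, the map $\Theta R:((x_1,\dots,x_n),(y_1,\dots,y_n))\mapsto((y'_1,\dots,y'_n),(x'_1,\dots,x'_n))$ is given by $$y'_j=y_j\frac{\kappa_{j+1}}{\kappa_j},\qquad x'_j=x_j\frac{\kappa_j}{\kappa_{j+1}},\qquad \kappa_j=\sum_{s=0}^{n-1}y_jy_{j+1}\cdots y_{j+s-1}\,x_{j+s+1}x_{j+s+2}\cdots x_{j+n-1},$$ where subscripts are interpreted mod $n$.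
   Context: Notation. Fix $n\ge2$; $[m]=\{1,\dots,m\}$, $[i,j]=\{m\in\mathbb Z: i\le m\le j\}$. For $k\in[n-1]$, $\mathbb X_k=\mathrm{Gr}(k,n)\times\mathbb C^\times$, with points written $N|t$. A subspace $N\in\mathrm{Gr}(k,n)$ is the column span of a full-rank $n\times k$ matrix, and $P_J(N)$ is the maximal minor of that matrix with row set $J$ (rows in increasing order), defined up to a common nonzero scalar. Index sets of integers are reduced modulo $n$ to subsets of $[n]$, and $P_I:=0$ if the reduced set does not have exactly $k$ elements. The map $g$. $\lambda$ is an indeterminate. $g(N|t)$ is the $n\times n$ matrix with entries $g(N|t)_{ij}=c_{ij}\,P_{[j-k+1,j-1]\cup\{i\}}(N)/P_{[j-k,j-1]}(N)$, where $c_{ij}=1$ if $j\le k$; $c_{ij}=t$ if $j>k$ and $i\ge j$; $c_{ij}=\lambda$ if $j>k$ and $i<j$. The geometric $R$-matrix. For $z\in\mathbb C^\times$ and an $n\times n$ matrix $A$ over $\mathbb C[\lambda,\lambda^{-1}]$, $\pi^k_z(A)=N|z$ where $N$ is the span of the first $k$ columns of $A|_{\lambda=(-1)^{k-1}z}$ (defined when these columns are linearly independent). Let $\mathrm{fl}(A)_{ij}=A_{n-j+1,n-i+1}$. Define $S:\mathbb X_k\to\mathbb X_k$ by $S(N|t)=\pi^k_t(\mathrm{fl}(g(N|t)))$, and on products $S(x_1,\dots,x_d)=(S(x_d),\dots,S(x_1))$. Define $\Psi_{k,\ell}:\mathbb X_\ell\times\mathbb X_k\to\mathbb X_k$ by $\Psi_{k,\ell}(M|s,N|t)=\pi^k_t(g(M|s)g(N|t))$.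 The geometric $R$-matrix is the rational map $R=(\Psi_{k,\ell},\ S\circ\Psi_{\ell,k}\circ S):\mathbb X_\ell\times\mathbb X_k\to\mathbb X_k\times\mathbb X_\ell$. Parametrization. $\mathbb T_1=(\mathbb C^\times)^{n}$ with points $(X_{11},X_{12},\dots,X_{1,n-1},s)$; put $X_{10}:=1$, $X_{1n}:=s$, $x_j=X_{1j}/X_{1,j-1}$ for $1\le j\le n$ (so $s=x_1\cdots x_n$). The birational isomorphism $\Theta_{n-1}:\mathbb T_1\to\mathbb X_{n-1}$ sends this point to $N|s$, where $N$ is the span of the first $n-1$ columns of the $n\times n$ matrix with diagonal entries $x_1,\dots,x_n$, entries $1$ immediately below the diagonal, and zeros elsewhere. *)

theory Defs
  imports
    "HOL-Computational_Algebra.Polynomial"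
    "Jordan_Normal_Form.DL_Rank"
    "Jordan_Normal_Form.DL_Submatrix"
begin

text \<open>
  The mathematical indices of rows, columns and coordinates run over \<open>1..n\<close>, those of
  matrices and vectors in the library over \<open>0..<n\<close>; integer indices are always the mathematical
  ones. A rational map is represented by a function into an option type, with value \<open>None\<close>
  where one of the expressions occurring in its definition is undefined; composites are formed
  pointwise.
\<close>

section \<open>Grassmannians and Pluecker coordinates\<close>

type_synonym point = "complex vec set \<times> complex"

definition Gr :: "nat \<Rightarrow> nat \<Rightarrow> complex vec set set" where
  "Gr n k = {vec_space.col_space n A | A. A \<in> carrier_mat n k \<and> vec_space.rank n A = k}"

definition XX :: "nat \<Rightarrow> nat \<Rightarrow> point set" where
  "XX n k = Gr n k \<times> (UNIV - {0})"

definition row_set :: "nat \<Rightarrow> int set \<Rightarrow> nat set" where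
  "row_set n J = (\<lambda>m. nat ((m - 1) mod int n)) ` J"

text \<open>
  Pluecker coordinates are only determined up to a common scalar. We fix one spanning matrix for
  each subspace; only ratios of the resulting values are used below.
\<close>

definition spanning_mat :: "nat \<Rightarrow> nat \<Rightarrow> complex vec set \<Rightarrow> complex mat" where
  "spanning_mat n k N =
     (SOME A. A \<in> carrier_mat n k \<and> vec_space.rank n A = k \<and> vec_space.col_space n A = N)"

definition plucker :: "nat \<Rightarrow> nat \<Rightarrow> complex vec set \<Rightarrow> int set \<Rightarrow> complex" where
  "plucker n k N J =
     (if card (row_set n J) = k
      then det (submatrix (spanning_mat n k N) (row_set n J) UNIV) else 0)"

section \<open>The map g\<close>

text \<open>
  All matrices to which \<open>proj_z\<close> is applied below have entries that are polynomials in the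
  indeterminate \<open>\<lambda>\<close>, so we work over \<open>\<complex>[\<lambda>]\<close> instead of \<open>\<complex>[\<lambda>,\<lambda>\<^sup>-\<^sup>1]\<close>; \<open>\<lambda>\<close> is \<open>[:0, 1:]\<close>.
\<close>

definition g_coeff :: "nat \<Rightarrow> complex \<Rightarrow> int \<Rightarrow> int \<Rightarrow> complex poly" where
  "g_coeff k t i j =
     (if j \<le> int k then 1 else if i \<ge> j then [:t:] else [:0, 1:])"

definition g_entry :: "nat \<Rightarrow> nat \<Rightarrow> point \<Rightarrow> int \<Rightarrow> int \<Rightarrow> complex poly" where
  "g_entry n k p i j =
     Polynomial.smult (plucker n k (fst p) ({j - int k + 1 .. j - 1} \<union> {i})
                       / plucker n k (fst p) {j - int k .. j - 1})
       (g_coeff k (snd p) i j)"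

definition g :: "nat \<Rightarrow> nat \<Rightarrow> point \<Rightarrow> complex poly mat option" where
  "g n k p =
     (if p \<in> XX n k \<and> (\<forall>j\<in>{1..int n}. plucker n k (fst p) {j - int k .. j - 1} \<noteq> 0)
      then Some (mat n n (\<lambda>(i, j). g_entry n k p (int i + 1) (int j + 1))) else None)"

section \<open>The geometric R-matrix\<close>

definition eval_mat :: "complex \<Rightarrow> complex poly mat \<Rightarrow> complex mat" where
  "eval_mat c A = map_mat (\<lambda>p. poly p c) A"

definition first_cols :: "nat \<Rightarrow> 'a mat \<Rightarrow> 'a mat" where
  "first_cols k A = mat (dim_row A) k (\<lambda>(i, j). A $$ (i, j))"

definition indep_cols :: "nat \<Rightarrow> complex mat \<Rightarrow> bool" where
  "indep_cols n A \<longleftrightarrow>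
     distinct (cols A) \<and> \<not> module.lin_dep class_ring (module_vec TYPE(complex) n) (set (cols A))"

definition proj_z :: "nat \<Rightarrow> nat \<Rightarrow> complex \<Rightarrow> complex poly mat \<Rightarrow> point option" where
  "proj_z n k z A =
     (let B = first_cols k (eval_mat ((-1) ^ (k - 1) * z) A)
      in if indep_cols n B then Some (vec_space.col_space n B, z) else None)"

definition fl :: "nat \<Rightarrow> 'a mat \<Rightarrow> 'a mat" where
  "fl n A = mat n n (\<lambda>(i, j). A $$ (n - 1 - j, n - 1 - i))"

definition S_map :: "nat \<Rightarrow> nat \<Rightarrow> point \<Rightarrow> point option" where
  "S_map n k p = Option.bind (g n k p) (\<lambda>A. proj_z n k (snd p) (fl n A))"

definition S_pair :: "nat \<Rightarrow> nat \<Rightarrow> nat \<Rightarrow> point \<times> point \<Rightarrow> (point \<times> point) option" where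
  "S_pair n l k = (\<lambda>(p, q).
     Option.bind (S_map n k q) (\<lambda>q'. Option.bind (S_map n l p) (\<lambda>p'. Some (q', p'))))"

text \<open>\<open>Psi n k l\<close> maps \<open>XX n l \<times> XX n k\<close> to \<open>XX n k\<close>.\<close>

definition Psi :: "nat \<Rightarrow> nat \<Rightarrow> nat \<Rightarrow> point \<times> point \<Rightarrow> point option" where
  "Psi n k l = (\<lambda>(p, q).
     Option.bind (g n l p) (\<lambda>A. Option.bind (g n k q) (\<lambda>B. proj_z n k (snd q) (A * B))))"

definition R_map :: "nat \<Rightarrow> nat \<Rightarrow> nat \<Rightarrow> point \<times> point \<Rightarrow> (point \<times> point) option" where
  "R_map n k l pq =
     Option.bind (Psi n k l pq) (\<lambda>q'.
     Option.bind (Option.bind (Option.bind (S_pair n l k pq) (Psi n l k)) (S_map n l)) (\<lambda>p'.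
     Some (q', p')))"

section \<open>The parametrization\<close>

text \<open>
  A point \<open>(X\<^sub>1\<^sub>1, \<dots>, X\<^sub>1\<^sub>,\<^sub>n\<^sub>-\<^sub>1, s)\<close> of the torus is a vector of length \<open>n\<close>, so that
  \<open>X\<^sub>1\<^sub>j\<close> is its entry with library index \<open>j - 1\<close> for all \<open>1 \<le> j \<le> n\<close>, including \<open>X\<^sub>1\<^sub>n = s\<close>.
\<close>

definition T1 :: "nat \<Rightarrow> complex vec set" where
  "T1 n = {X \<in> carrier_vec n. \<forall>i<n. X $ i \<noteq> 0}"

definition X1 :: "complex vec \<Rightarrow> nat \<Rightarrow> complex" where
  "X1 X j = (if j = 0 then 1 else X $ (j - 1))"

text \<open>The coordinates \<open>x\<^sub>j\<close>, with the subscript reduced modulo \<open>n\<close> to \<open>1..n\<close>.\<close>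

definition coord :: "nat \<Rightarrow> complex vec \<Rightarrow> int \<Rightarrow> complex" where
  "coord n X j = (let m = nat ((j - 1) mod int n) + 1 in X1 X m / X1 X (m - 1))"

definition bidiag_mat :: "nat \<Rightarrow> complex vec \<Rightarrow> complex mat" where
  "bidiag_mat n X = mat n n (\<lambda>(i, j).
     if i = j then coord n X (int i + 1) else if i = j + 1 then 1 else 0)"

definition Theta :: "nat \<Rightarrow> complex vec \<Rightarrow> point" where
  "Theta n X = (vec_space.col_space n (first_cols (n - 1) (bidiag_mat n X)), X1 X n)"

text \<open>
  \<open>Theta n\<close> is injective on the torus, and its inverse is defined on its image, which is the
  locus in \<open>XX n (n - 1)\<close> where no Pluecker coordinate vanishes.
\<close>

definition Theta_inv :: "nat \<Rightarrow> point \<Rightarrow> complex vec option" where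
  "Theta_inv n p = (if p \<in> Theta n ` T1 n then Some (the_inv_into (T1 n) (Theta n) p) else None)"

definition ThetaR ::
    "nat \<Rightarrow> complex vec \<times> complex vec \<Rightarrow> (complex vec \<times> complex vec) option" where
  "ThetaR n = (\<lambda>(X, Y).
     Option.bind (R_map n (n - 1) (n - 1) (Theta n X, Theta n Y)) (\<lambda>(q, p).
     Option.bind (Theta_inv n q) (\<lambda>Y'. Option.bind (Theta_inv n p) (\<lambda>X'. Some (Y', X')))))"

definition kappa :: "nat \<Rightarrow> (int \<Rightarrow> complex) \<Rightarrow> (int \<Rightarrow> complex) \<Rightarrow> int \<Rightarrow> complex" where
  "kappa n x y j =
     (\<Sum>s\<in>{0..int n - 1}. (\<Prod>i\<in>{j..j + s - 1}. y i) * (\<Prod>i\<in>{j + s + 1..j + int n - 1}. x i))"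

section \<open>Nonempty Zariski-open sets\<close>

inductive poly_fun :: "nat \<Rightarrow> (complex vec \<times> complex vec \<Rightarrow> complex) \<Rightarrow> bool" for n :: nat where
  const: "poly_fun n (\<lambda>p. c)"
| fst_coord: "i < n \<Longrightarrow> poly_fun n (\<lambda>p. fst p $ i)"
| snd_coord: "i < n \<Longrightarrow> poly_fun n (\<lambda>p. snd p $ i)"
| add: "poly_fun n F \<Longrightarrow> poly_fun n G \<Longrightarrow> poly_fun n (\<lambda>p. F p + G p)"
| mult: "poly_fun n F \<Longrightarrow> poly_fun n G \<Longrightarrow> poly_fun n (\<lambda>p. F p * G p)"

text \<open>
  \<open>generic n D\<close> says that \<open>D\<close> contains a nonempty, hence dense, Zariski-open subset of the
  irreducible variety \<open>T1 n \<times> T1 n\<close>.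
\<close>

definition generic :: "nat \<Rightarrow> (complex vec \<times> complex vec) set \<Rightarrow> bool" where
  "generic n D \<longleftrightarrow>
     (\<exists>F. poly_fun n F \<and> (\<exists>p \<in> T1 n \<times> T1 n. F p \<noteq> 0) \<and>
          (\<forall>p \<in> T1 n \<times> T1 n. F p \<noteq> 0 \<longrightarrow> p \<in> D))"

end

theory Submission
  imports Defs
begin

text \<open>
  A point of \<open>Gr(n - 1, n)\<close> is a hyperplane, hence given by a normal vector up to a scalar. The
  first \<open>n - 1\<close> columns of the bidiagonal matrix that defines \<open>Theta\<close> are annihilated by the vector \<open>w(X)\<close> with entries
  \<open>(-1)\<^sup>i X\<^sub>1\<^sub>i\<close> for \<open>0 \<le> i < n\<close>; consequently the Pluecker coordinates of \<open>Theta n X\<close> are the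
  \<open>X\<^sub>1\<^sub>i\<close> up to a common factor, and \<open>g\<close> takes there the value \<open>L(x)\<close> with diagonal \<open>x\<^sub>1, \<dots>, x\<^sub>n\<close>,
  ones below the diagonal and \<open>\<lambda>\<close> in the upper right corner (\<open>g_Theta\<close>).

  Put \<open>s = x\<^sub>1 \<cdots> x\<^sub>n\<close> and \<open>t = y\<^sub>1 \<cdots> y\<^sub>n\<close>. The first component of the R-matrix is the column space of
  \<open>L(x) B(y)\<close>, where \<open>\<lambda> = (-1)\<^sup>n t\<close> and \<open>B(y)\<close> consists of the first \<open>n - 1\<close> columns of \<open>L(y)\<close>. The
  identity \<open>x\<^sub>j \<kappa>\<^sub>j - y\<^sub>j \<kappa>\<^bsub>j+1\<^esub> = s - t\<close> comes from a telescoping sum (\<open>kap_recurrence\<close>). It says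
  precisely that the vector \<open>v\<close> with entries \<open>(-1)\<^sup>i Y\<^sub>1\<^sub>i \<kappa>\<^bsub>i+1\<^esub>\<close> satisfies
  \<open>v\<^sup>T L(x) = (s - t) w(Y)\<^sup>T\<close>, and therefore \<open>v\<^sup>T L(x) B(y) = 0\<close> (\<open>normal_prod_mat\<close>). Thus, if no
  \<open>\<kappa>\<^sub>j\<close> vanishes, \<open>v\<close> is a normal vector of the first component, which is the point with coordinates
  \<open>Y'\<^sub>1\<^sub>i = Y\<^sub>1\<^sub>i \<kappa>\<^bsub>i+1\<^esub> / \<kappa>\<^sub>1\<close>, that is \<open>y'\<^sub>j = y\<^sub>j \<kappa>\<^bsub>j+1\<^esub> / \<kappa>\<^sub>j\<close>
  (\<open>Psi_Theta_generic\<close>).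

  The flip turns \<open>L(x)\<close> into the same matrix for the reversed tuple, so \<open>S\<close> becomes \<open>x\<^sub>j \<mapsto> x\<^bsub>n+1-j\<^esub>\<close>
  (\<open>S_map_Theta\<close>). Reversing and exchanging \<open>x\<close> and \<open>y\<close> replaces \<open>\<kappa>\<^sub>j\<close> by \<open>\<kappa>\<^bsub>n+2-j\<^esub>\<close>
  (\<open>kap_torus_rev\<close>), so the formula for the second component is the first one transported by this
  symmetry.

  It remains to see that the map is undefined as soon as some \<open>\<kappa>\<^sub>j\<close> vanishes (\<open>ThetaR_SomeD\<close>). A value
  in the image of \<open>Theta\<close> makes \<open>v\<close> a multiple of a vector without zero entries, so only \<open>v = 0\<close> has
  to be excluded. In that case \<open>s = t\<close>, and \<open>L(x)\<close> is singular with a kernel vector \<open>z\<close> satisfying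
  \<open>s (w(Y) \<bullet> z) = \<kappa>\<^sub>1 = 0\<close>; then \<open>z\<close> lies in the column space of \<open>B(y)\<close>, so that the columns of
  \<open>L(x) B(y)\<close> are dependent and the first component is undefined. The locus where no
  \<open>\<kappa>\<^sub>j\<close> vanishes is nonempty and Zariski-open (\<open>generic_kap_nonzero\<close>).
\<close>

section \<open>Hyperplanes as column spaces\<close>

lemma mult_mat_unit_vec:
  fixes A :: "complex mat"
  assumes A: "A \<in> carrier_mat n k" and i: "i < k"
  shows "A *\<^sub>v unit_vec k i = col A i"
  using assms by (intro eq_vecI) (auto simp: scalar_prod_right_unit)

text \<open>
  If two columns coincide, the difference of the corresponding unit vectors is a kernel vector, so
  injectivity also covers the distinctness clause in \<open>indep_cols\<close>.
\<close>

lemma indep_cols_iff_injective: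
  assumes A: "A \<in> carrier_mat n k"
  shows "indep_cols n A \<longleftrightarrow> (\<forall>b\<in>carrier_vec k. A *\<^sub>v b = 0\<^sub>v n \<longrightarrow> b = 0\<^sub>v k)"
proof -
  interpret vec_space "TYPE(complex)" n .
  show ?thesis
  proof (cases "distinct (cols A)")
    case True
    then show ?thesis
      unfolding indep_cols_def using lin_depI[OF A] lin_depE[OF A] by metis
  next
    case False
    then obtain i j where ij: "i < k" "j < k" "i \<noteq> j" "col A i = col A j"
      using A by (auto simp: distinct_conv_nth)
    \<comment> \<open>Equal columns \<open>i\<close> and \<open>j\<close> give this kernel vector.\<close>
    define b :: "complex vec" where "b = unit_vec k i - unit_vec k j"
    have "A *\<^sub>v b = col A i - col A j"
      unfolding b_def using A ij
      by (subst mult_minus_distrib_mat_vec[of _ n k]) (auto simp: mult_mat_unit_vec[OF A])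
    also have "\<dots> = 0\<^sub>v n" using A ij by (auto intro!: eq_vecI)
    finally have "A *\<^sub>v b = 0\<^sub>v n" .
    moreover have "b $ i = 1" using ij by (simp add: b_def)
    then have "b \<noteq> 0\<^sub>v k" using ij by auto
    moreover have "b \<in> carrier_vec k" by (simp add: b_def)
    ultimately show ?thesis using False unfolding indep_cols_def by blast
  qed
qed

lemma rank_eq_iff_indep_cols:
  assumes A: "A \<in> carrier_mat n k"
  shows "vec_space.rank n A = k \<longleftrightarrow> indep_cols n A"
proof -
  interpret vec_space "TYPE(complex)" n .
  show ?thesis
  proof (cases "distinct (cols A)")
    case True
    then show ?thesis
      unfolding indep_cols_def using lin_indpt_full_rank[OF A] full_rank_lin_indpt[OF A] by metis
  next
    case False
    obtain S where S: "maximal S (\<lambda>T. T \<subseteq> set (cols A) \<and> lin_indpt T)"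
      using maximal_exists_superset[of "set (cols A)" "\<lambda>T. T \<subseteq> set (cols A) \<and> lin_indpt T" "{}"]
      by (auto simp: finite_lin_indpt2)
    then have "card S \<le> card (set (cols A))" by (simp add: card_mono maximal_def)
    also have "\<dots> < length (cols A)" using False
      by (metis card_distinct card_length le_neq_implies_less)
    also have "\<dots> = k" using A by simp
    finally have "rank A < k" using rank_card_indpt[OF A S] by simp
    then show ?thesis using False by (simp add: indep_cols_def)
  qed
qed

definition hyperplane :: "nat \<Rightarrow> complex vec \<Rightarrow> complex vec set" where
  "hyperplane n w = {u \<in> carrier_vec n. w \<bullet> u = 0}"

section \<open>Normal vectors and maximal minors\<close>

text \<open>
  If the columns of \<open>A\<close> are independent, the determinant of \<open>A\<close> completed by a last column \<open>u\<close> detects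
  whether \<open>u\<close> lies in the column space of \<open>A\<close>; expanding it along that column brings in the maximal minors
  of \<open>A\<close>. This links the normal vector of the column space with the Pluecker coordinates.
\<close>

definition append_col :: "nat \<Rightarrow> complex mat \<Rightarrow> complex vec \<Rightarrow> complex mat" where
  "append_col n A u = mat n n (\<lambda>(i, j). if j = n - 1 then u $ i else A $$ (i, j))"

lemma append_col_mult:
  assumes A: "A \<in> carrier_mat n (n - 1)" and u: "u \<in> carrier_vec n" and b: "b \<in> carrier_vec n"
    and n: "n > 0"
  shows "append_col n A u *\<^sub>v b = A *\<^sub>v vec_first b (n - 1) + (b $ (n - 1)) \<cdot>\<^sub>v u"
proof (rule eq_vecI)
  obtain m where m: "n = Suc m" using n by (cases n) auto
  show "dim_vec (append_col n A u *\<^sub>v b) = dim_vec (A *\<^sub>v vec_first b (n - 1) + (b $ (n - 1)) \<cdot>\<^sub>v u)"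
    using A u by (simp add: append_col_def)
  fix i assume "i < dim_vec (A *\<^sub>v vec_first b (n - 1) + (b $ (n - 1)) \<cdot>\<^sub>v u)"
  then have i: "i < n" using u by simp
  show "(append_col n A u *\<^sub>v b) $ i = (A *\<^sub>v vec_first b (n - 1) + (b $ (n - 1)) \<cdot>\<^sub>v u) $ i"
    using i A u b by (simp add: append_col_def scalar_prod_def vec_first_def m)
qed

lemma transpose_null_imp:
  fixes A :: "complex mat"
  assumes A: "A \<in> carrier_mat n k" and w: "w \<in> carrier_vec n" and wA: "A\<^sup>T *\<^sub>v w = 0\<^sub>v k"
    and b: "b \<in> carrier_vec k"
  shows "w \<bullet> (A *\<^sub>v b) = 0"
proof -
  have "w \<bullet> (A *\<^sub>v b) = (A\<^sup>T *\<^sub>v w) \<bullet> b"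
    using transpose_vec_mult_scalar[OF A b w] by simp
  then show ?thesis using wA b by simp
qed

lemma col_space_range:
  fixes A :: "complex mat"
  assumes A: "A \<in> carrier_mat n k"
  shows "vec_space.col_space n A = {A *\<^sub>v b | b. b \<in> carrier_vec k}"
proof -
  interpret vec_space "TYPE(complex)" n .
  show ?thesis unfolding col_space_eq[OF A] using A by auto
qed

text \<open>
  A kernel vector of the completed matrix has nonzero last entry because the columns of \<open>A\<close> are
  independent, so it exhibits \<open>u\<close> as a combination of them. Conversely, if \<open>w\<close> is orthogonal to
  \<open>u\<close> as well, it is a nonzero left null vector of the completed matrix.
\<close>

lemma det_append_col_eq_0_iff:
  assumes A: "A \<in> carrier_mat n (n - 1)" and ind: "indep_cols n A"
    and w: "w \<in> carrier_vec n" "\<And>b. b \<in> carrier_vec (n - 1) \<Longrightarrow> w \<bullet> (A *\<^sub>v b) = 0"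
    and w0: "w \<noteq> 0\<^sub>v n" and u: "u \<in> carrier_vec n" and n: "n > 0"
  shows "det (append_col n A u) = 0 \<longleftrightarrow> w \<bullet> u = 0"
    and "w \<bullet> u = 0 \<longleftrightarrow> u \<in> vec_space.col_space n A"
proof -
  have M: "append_col n A u \<in> carrier_mat n n" by (simp add: append_col_def)
  have split: "w \<bullet> (append_col n A u *\<^sub>v b) = b $ (n - 1) * (w \<bullet> u)" if b: "b \<in> carrier_vec n" for b
    using b A u w
    by (subst append_col_mult[OF A u b n], subst scalar_prod_add_distrib[of _ n]) auto
  have col: "u \<in> vec_space.col_space n A \<Longrightarrow> w \<bullet> u = 0"
    unfolding col_space_range[OF A] using w by auto
  have 1: "u \<in> vec_space.col_space n A" if d: "det (append_col n A u) = 0"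
  proof -
    obtain b where b: "b \<in> carrier_vec n" "b \<noteq> 0\<^sub>v n" "append_col n A u *\<^sub>v b = 0\<^sub>v n"
      using d unfolding det_0_iff_vec_prod_zero[OF M] by blast
    let ?f = "vec_first b (n - 1)" and ?c = "b $ (n - 1)"
    have eq: "A *\<^sub>v ?f + ?c \<cdot>\<^sub>v u = 0\<^sub>v n" using append_col_mult[OF A u b(1) n] b(3) by simp
    \<comment> \<open>With last entry \<open>0\<close>, the rest of \<open>b\<close> would be a kernel vector of \<open>A\<close>.\<close>
    have "?c \<noteq> 0"
    proof
      assume c: "?c = 0"
      have "A *\<^sub>v ?f + ?c \<cdot>\<^sub>v u = A *\<^sub>v ?f"
        using c A u by (intro eq_vecI) (auto simp del: index_mult_mat_vec)
      then have "A *\<^sub>v ?f = 0\<^sub>v n" using eq by simp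
      then have f: "?f = 0\<^sub>v (n - 1)" using ind unfolding indep_cols_iff_injective[OF A] by simp
      have "b $ i = 0" if "i < n" for i
      proof (cases "i = n - 1")
        case False
        then have "i < n - 1" using that by simp
        then have "?f $ i = b $ i" using b n by (simp add: vec_first_def)
        then show ?thesis using f \<open>i < n - 1\<close> by simp
      qed (use c in simp)
      then show False using b by auto
    qed
    have "u = A *\<^sub>v ((- 1 / ?c) \<cdot>\<^sub>v ?f)"
    proof (rule eq_vecI)
      fix i assume "i < dim_vec (A *\<^sub>v ((- 1 / ?c) \<cdot>\<^sub>v ?f))"
      then have i: "i < n" using A by simp
      have "(A *\<^sub>v ?f + ?c \<cdot>\<^sub>v u) $ i = 0" using eq i by simp
      then have "(A *\<^sub>v ?f) $ i + ?c * u $ i = 0" using i A u by (simp del: index_mult_mat_vec)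
      then have "u $ i = (- 1 / ?c) * (A *\<^sub>v ?f) $ i" using \<open>?c \<noteq> 0\<close> 
        by (simp add: field_simps eq_neg_iff_add_eq_0 del: index_mult_mat_vec)
      then show "u $ i = (A *\<^sub>v ((- 1 / ?c) \<cdot>\<^sub>v ?f)) $ i"
        using i A by (subst mult_mat_vec[OF A]) (auto simp del: index_mult_mat_vec)
    qed (use A u in auto)
    then show ?thesis unfolding col_space_range[OF A] by auto
  qed
  have 2: "det (append_col n A u) = 0" if d: "w \<bullet> u = 0"
  proof -
    have "(append_col n A u)\<^sup>T *\<^sub>v w = 0\<^sub>v n"
    proof (rule eq_vecI)
      fix i assume "i < dim_vec (0\<^sub>v n :: complex vec)"
      then have i: "i < n" by simp
      have "((append_col n A u)\<^sup>T *\<^sub>v w) $ i = w \<bullet> (append_col n A u *\<^sub>v unit_vec n i)"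
        using i M w by (simp add: mult_mat_unit_vec[OF M] comm_scalar_prod[of _ n])
      also have "\<dots> = 0" by (subst split) (auto simp: d)
      finally show "((append_col n A u)\<^sup>T *\<^sub>v w) $ i = 0\<^sub>v n $ i" using i by simp
    qed (use M in auto)
    then have "det ((append_col n A u)\<^sup>T) = 0"
      using w0 w M by (subst det_0_iff_vec_prod_zero[of _ n]) auto
    then show ?thesis using M by (simp add: det_transpose)
  qed
  show "det (append_col n A u) = 0 \<longleftrightarrow> w \<bullet> u = 0" using 1 2 col by blast
  show "w \<bullet> u = 0 \<longleftrightarrow> u \<in> vec_space.col_space n A" using 1 2 col by blast
qed

lemma col_space_eq_hyperplane:
  assumes A: "A \<in> carrier_mat n (n - 1)" and ind: "indep_cols n A"
    and w: "w \<in> carrier_vec n" "\<And>b. b \<in> carrier_vec (n - 1) \<Longrightarrow> w \<bullet> (A *\<^sub>v b) = 0"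
    and w0: "w \<noteq> 0\<^sub>v n" and n: "n > 0"
  shows "vec_space.col_space n A = hyperplane n w"
  using det_append_col_eq_0_iff(2)[OF A ind w w0 _ n] A
  unfolding hyperplane_def by (auto simp: col_space_range[OF A])

text \<open>
  The vector \<open>w\<^sub>i e\<^sub>j - w\<^sub>j e\<^sub>i\<close> lies in the first hyperplane, and pairing it with \<open>v\<close> gives the
  relation. In this cross-multiplied form it also covers \<open>v = 0\<close>.
\<close>

lemma hyperplane_subset_imp_proportional:
  assumes w: "w \<in> carrier_vec n" and v: "v \<in> carrier_vec n"
    and sub: "hyperplane n w \<subseteq> hyperplane n v" and ij: "i < n" "j < n"
  shows "w $ i * v $ j = w $ j * v $ i"
proof -
  define u :: "complex vec" where "u = w $ i \<cdot>\<^sub>v unit_vec n j - w $ j \<cdot>\<^sub>v unit_vec n i"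
  have u: "z \<bullet> u = w $ i * z $ j - w $ j * z $ i" if "z \<in> carrier_vec n" for z
    unfolding u_def using that ij by (subst scalar_prod_minus_distrib[of _ n]) auto
  have "u \<in> hyperplane n w" using u[OF w] by (simp add: hyperplane_def u_def mult.commute)
  then have "v \<bullet> u = 0" using sub by (auto simp: hyperplane_def)
  then show ?thesis using u[OF v] by simp
qed

lemma pick_remove:
  assumes "r < n" "i < n - 1"
  shows "pick ({..<n} - {r}) i = (if i < r then i else Suc i)"
proof (cases "i < r")
  case True
  have "{a \<in> {..<n} - {r}. a < i} = {..<i}" using True assms by auto
  then show ?thesis using pick_card_in_set[of i "{..<n} - {r}"] True assms by simp
next
  case False
  have "{a \<in> {..<n} - {r}. a < Suc i} = {..<Suc i} - {r}" using False assms by auto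
  then have "card {a \<in> {..<n} - {r}. a < Suc i} = i" using False by simp
  then show ?thesis using pick_card_in_set[of "Suc i" "{..<n} - {r}"] False assms by simp
qed

lemma mat_delete_append_col:
  assumes A: "A \<in> carrier_mat n (n - 1)" and r: "r < n"
  shows "mat_delete (append_col n A u) r (n - 1) = submatrix A ({..<n} - {r}) UNIV"
proof -
  have "{i. i < n \<and> i \<noteq> r} = {..<n} - {r}" by auto
  then have c: "card {i. i < n \<and> i \<noteq> r} = n - 1" using r by simp
  show ?thesis
  proof (rule eq_matI)
    fix i j assume "i < dim_row (submatrix A ({..<n} - {r}) UNIV)"
      and "j < dim_col (submatrix A ({..<n} - {r}) UNIV)"
    then have "i < n - 1" "j < n - 1" using A c by (simp_all add: dim_submatrix)
    then show "mat_delete (append_col n A u) r (n - 1) $$ (i, j)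
        = submatrix A ({..<n} - {r}) UNIV $$ (i, j)"
      using A c pick_remove[OF r \<open>i < n - 1\<close>]
      by (auto simp: mat_delete_def submatrix_def append_col_def pick_UNIV)
  qed (use A c in \<open>simp_all add: mat_delete_def dim_submatrix append_col_def\<close>)
qed

lemma det_append_col:
  assumes A: "A \<in> carrier_mat n (n - 1)" and n: "n > 0"
  shows "det (append_col n A u) =
    (\<Sum>r<n. u $ r * ((-1) ^ (r + (n - 1)) * det (submatrix A ({..<n} - {r}) UNIV)))"
proof -
  have M: "append_col n A u \<in> carrier_mat n n" by (simp add: append_col_def)
  show ?thesis
    using n by (subst laplace_expansion_column[OF M, of "n - 1"])
      (auto simp: cofactor_def mat_delete_append_col[OF A, simplified], simp add: append_col_def)
qed

text \<open>
  The functional \<open>u \<mapsto> det [A | u]\<close> vanishes exactly on the column space of \<open>A\<close>, so the vector of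
  its coefficients, which are the signed maximal minors, is a nonzero multiple of any normal vector.
\<close>

lemma maximal_minors_proportional:
  assumes A: "A \<in> carrier_mat n (n - 1)" and ind: "indep_cols n A"
    and col: "vec_space.col_space n A = hyperplane n w" and w: "w \<in> carrier_vec n"
    and w0: "w \<noteq> 0\<^sub>v n" and n: "n > 0"
  obtains c where "c \<noteq> 0"
    "\<And>r. r < n \<Longrightarrow> det (submatrix A ({..<n} - {r}) UNIV) = c * ((-1) ^ r * w $ r)"
proof -
  have wA: "w \<bullet> (A *\<^sub>v b) = 0" if "b \<in> carrier_vec (n - 1)" for b
    using that col unfolding col_space_range[OF A] hyperplane_def by blast
  define v where "v = vec n (\<lambda>r. (-1) ^ (r + (n - 1)) * det (submatrix A ({..<n} - {r}) UNIV))"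
  have v: "v \<in> carrier_vec n" by (simp add: v_def)
  have det: "det (append_col n A u) = v \<bullet> u" if "u \<in> carrier_vec n" for u
    using that unfolding det_append_col[OF A n]
    by (auto simp: scalar_prod_def v_def lessThan_atLeast0 mult_ac intro!: sum.cong)
  have sub: "hyperplane n w \<subseteq> hyperplane n v"
    using det_append_col_eq_0_iff(1)[OF A ind w wA w0 _ n] det by (auto simp: hyperplane_def)
  obtain i where i: "i < n" "w $ i \<noteq> 0" using w w0 by (metis eq_vecI carrier_vecD index_zero_vec)
  have "v $ i \<noteq> 0"
    using det_append_col_eq_0_iff(1)[OF A ind w wA w0 _ n, of "unit_vec n i"] det[of "unit_vec n i"] i v w
    by simp
  show thesis
  proof (rule that[of "(-1) ^ (n - 1) * v $ i / w $ i"])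
    show "(-1) ^ (n - 1) * v $ i / w $ i \<noteq> 0" using \<open>v $ i \<noteq> 0\<close> i by simp
    fix r assume r: "r < n"
    have "v $ r = v $ i / w $ i * w $ r"
      using hyperplane_subset_imp_proportional[OF w v sub i(1) r] i by (simp add: field_simps)
    then have "(-1) ^ (r + (n - 1)) * ((-1) ^ (r + (n - 1)) * det (submatrix A ({..<n} - {r}) UNIV))
        = (-1) ^ (r + (n - 1)) * (v $ i / w $ i * w $ r)"
      using r by (simp add: v_def)
    then show "det (submatrix A ({..<n} - {r}) UNIV) = (-1) ^ (n - 1) * v $ i / w $ i * ((-1) ^ r * w $ r)"
      by (simp add: mult.assoc[symmetric] power_add[symmetric] power_mult_distrib[symmetric] flip: power_mult)
        (simp add: power_add)
  qed
qed

section \<open>Torus coordinates\<close>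

lemma X1_0 [simp]: "X1 X 0 = 1" by (simp add: X1_def)

lemma X1_nonzero: "X \<in> T1 n \<Longrightarrow> m \<le> n \<Longrightarrow> X1 X m \<noteq> 0"
  by (auto simp: X1_def T1_def)

lemma T1_eqI:
  assumes "X \<in> T1 n" "Y \<in> T1 n" "\<And>m. m \<le> n \<Longrightarrow> X1 X m = X1 Y m"
  shows "X = Y"
proof (rule eq_vecI)
  fix i assume "i < dim_vec Y"
  then have "Suc i \<le> n" using assms(2) by (auto simp: T1_def)
  from assms(3)[OF this] show "X $ i = Y $ i" by (simp add: X1_def)
qed (use assms in \<open>auto simp: T1_def\<close>)

lemma coord_Suc: "i < n \<Longrightarrow> coord n X (int i + 1) = X1 X (Suc i) / X1 X i"
  by (simp add: coord_def)

lemma coord_add_n: "coord n X (j + int n) = coord n X j"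
proof -
  have "(j + int n - 1) mod int n = (j - 1) mod int n"
    by (metis diff_add_eq mod_add_self2)
  then show ?thesis by (simp add: coord_def)
qed

lemma X1_Suc: "X \<in> T1 n \<Longrightarrow> i < n \<Longrightarrow> X1 X (Suc i) = coord n X (int i + 1) * X1 X i"
  using X1_nonzero[of X n i] by (simp add: coord_Suc)

lemma coord_nonzero: "X \<in> T1 n \<Longrightarrow> n > 0 \<Longrightarrow> coord n X j \<noteq> 0"
proof -
  assume X: "X \<in> T1 n" and n: "n > 0"
  have "nat ((j - 1) mod int n) < n" using n by (simp add: nat_less_iff)
  then show ?thesis using X1_nonzero[OF X] by (simp add: coord_def Let_def)
qed

lemma prod_coord:
  assumes X: "X \<in> T1 n" and m: "m \<le> n"
  shows "(\<Prod>i\<in>{1..int m}. coord n X i) = X1 X m"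
  using m
proof (induction m)
  case (Suc m)
  have "{1..int (Suc m)} = insert (int m + 1) {1..int m}" by auto
  then show ?case using Suc X1_Suc[OF X, of m] by simp
qed simp

section \<open>The parametrized hyperplanes\<close>

text \<open>
  All normal vectors below alternate in sign, since a bidiagonal matrix with entries \<open>x\<^sub>j\<close>
  and \<open>1\<close> is annihilated by products of the \<open>-x\<^sub>j\<close>.
\<close>

definition alternating :: "nat \<Rightarrow> (nat \<Rightarrow> complex) \<Rightarrow> complex vec" where
  "alternating n a = vec n (\<lambda>i. (-1) ^ i * a i)"

definition Theta_mat :: "nat \<Rightarrow> complex vec \<Rightarrow> complex mat" where
  "Theta_mat n X = first_cols (n - 1) (bidiag_mat n X)"

lemma alternating_carrier [simp]: "alternating n a \<in> carrier_vec n"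
  by (simp add: alternating_def)

lemma Theta_mat_carrier [simp]: "Theta_mat n X \<in> carrier_mat n (n - 1)"
  by (simp add: Theta_mat_def first_cols_def bidiag_mat_def)

lemma sum_two_terms:
  fixes f :: "nat \<Rightarrow> 'a::comm_monoid_add"
  assumes "a < n" "b < n" "a \<noteq> b" "\<And>i. i < n \<Longrightarrow> i \<noteq> a \<Longrightarrow> i \<noteq> b \<Longrightarrow> f i = 0"
  shows "(\<Sum>i = 0..<n. f i) = f a + f b"
proof -
  have "(\<Sum>i = 0..<n. f i) = (\<Sum>i\<in>{a, b}. f i)"
    using assms by (intro sum.mono_neutral_right) auto
  then show ?thesis using assms(3) by simp
qed

lemma alternating_Theta_mat:
  assumes X: "X \<in> T1 n" and b: "b \<in> carrier_vec (n - 1)"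
  shows "alternating n (X1 X) \<bullet> (Theta_mat n X *\<^sub>v b) = 0"
proof -
  have "((Theta_mat n X)\<^sup>T *\<^sub>v alternating n (X1 X)) $ j = 0" if j: "j < n - 1" for j
  proof -
    have "((Theta_mat n X)\<^sup>T *\<^sub>v alternating n (X1 X)) $ j
        = (\<Sum>i = 0..<n. bidiag_mat n X $$ (i, j) * ((-1) ^ i * X1 X i))"
      using j by (simp add: Theta_mat_def first_cols_def bidiag_mat_def alternating_def scalar_prod_def)
    also have "\<dots> = bidiag_mat n X $$ (j, j) * ((-1) ^ j * X1 X j)
        + bidiag_mat n X $$ (Suc j, j) * ((-1) ^ Suc j * X1 X (Suc j))"
      using j by (intro sum_two_terms) (auto simp: bidiag_mat_def)
    also have "\<dots> = 0" using j X1_Suc[OF X, of j] by (simp add: bidiag_mat_def)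
    finally show ?thesis .
  qed
  then have "(Theta_mat n X)\<^sup>T *\<^sub>v alternating n (X1 X) = 0\<^sub>v (n - 1)"
    by (intro eq_vecI) (auto simp: Theta_mat_def first_cols_def)
  then show ?thesis using transpose_null_imp[OF Theta_mat_carrier alternating_carrier] b by blast
qed

lemma indep_cols_Theta_mat:
  assumes X: "X \<in> T1 n"
  shows "indep_cols n (Theta_mat n X)"
  unfolding indep_cols_iff_injective[OF Theta_mat_carrier]
proof (intro ballI impI)
  fix b :: "complex vec" assume b: "b \<in> carrier_vec (n - 1)" and 0: "Theta_mat n X *\<^sub>v b = 0\<^sub>v n"
  have row: "(\<Sum>j = 0..<n - 1. bidiag_mat n X $$ (i, j) * b $ j) = 0" if "i < n" for i
  proof -
    have "(Theta_mat n X *\<^sub>v b) $ i = (\<Sum>j = 0..<n - 1. bidiag_mat n X $$ (i, j) * b $ j)"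
      using that b by (simp add: Theta_mat_def first_cols_def bidiag_mat_def scalar_prod_def)
    then show ?thesis using 0 that by simp
  qed
  have "b $ i = 0" if "i < n - 1" for i
    using that
  proof (induction i)
    case 0
    have "(\<Sum>j = 0..<n - 1. bidiag_mat n X $$ (0, j) * b $ j)
        = (\<Sum>j\<in>{0}. bidiag_mat n X $$ (0, j) * b $ j)"
      using 0 by (intro sum.mono_neutral_right) (auto simp: bidiag_mat_def)
    then have "coord n X 1 * b $ 0 = 0" using row[of 0] 0 by (simp add: bidiag_mat_def)
    then show ?case using coord_nonzero[OF X] 0 by simp
  next
    case (Suc i)
    have "(\<Sum>j = 0..<n - 1. bidiag_mat n X $$ (Suc i, j) * b $ j)
        = bidiag_mat n X $$ (Suc i, i) * b $ i + bidiag_mat n X $$ (Suc i, Suc i) * b $ Suc i"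
      using Suc.prems by (intro sum_two_terms) (auto simp: bidiag_mat_def)
    then have "coord n X (int (Suc i) + 1) * b $ Suc i = 0"
      using row[of "Suc i"] Suc by (simp add: bidiag_mat_def)
    then show ?case using coord_nonzero[OF X] Suc.prems by simp
  qed
  then show "b = 0\<^sub>v (n - 1)" using b by (intro eq_vecI) auto
qed

lemma alternating_nonzero:
  assumes "a i \<noteq> 0" "i < n"
  shows "alternating n a \<noteq> 0\<^sub>v n"
proof
  assume "alternating n a = 0\<^sub>v n"
  then have "alternating n a $ i = 0" using assms by simp
  then show False using assms by (simp add: alternating_def)
qed

text \<open>
  Since \<open>X\<^sub>1\<^sub>0 = 1\<close>, the normal vector is normalised in its first entry, so the coordinates can be
  read off from the hyperplane. This makes \<open>Theta\<close> injective and computes its inverse.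
\<close>

lemma Theta_eq_hyperplane:
  assumes X: "X \<in> T1 n" and n: "n > 0"
  shows "Theta n X = (hyperplane n (alternating n (X1 X)), X1 X n)"
proof -
  have "alternating n (X1 X) \<noteq> 0\<^sub>v n" using n by (intro alternating_nonzero[of _ 0]) auto
  then show ?thesis
    using col_space_eq_hyperplane[OF Theta_mat_carrier indep_cols_Theta_mat[OF X] alternating_carrier
        alternating_Theta_mat[OF X] _ n]
    unfolding Theta_def Theta_mat_def by simp
qed

lemma inj_on_Theta:
  assumes n: "n > 0"
  shows "inj_on (Theta n) (T1 n)"
proof (rule inj_onI)
  fix X Y assume X: "X \<in> T1 n" and Y: "Y \<in> T1 n" and eq: "Theta n X = Theta n Y"
  have "X1 X m = X1 Y m" if m: "m \<le> n" for m
  proof (cases "m = n")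
    case True
    then show ?thesis using eq unfolding Theta_eq_hyperplane[OF X n] Theta_eq_hyperplane[OF Y n] by simp
  next
    case False
    have "hyperplane n (alternating n (X1 X)) \<subseteq> hyperplane n (alternating n (X1 Y))"
      using eq unfolding Theta_eq_hyperplane[OF X n] Theta_eq_hyperplane[OF Y n] by simp
    from hyperplane_subset_imp_proportional[OF _ _ this n, of m] m False n
    show ?thesis by (simp add: alternating_def)
  qed
  then show "X = Y" by (rule T1_eqI[OF X Y])
qed

lemma Theta_inv_Theta:
  assumes "X \<in> T1 n" "n > 0"
  shows "Theta_inv n (Theta n X) = Some X"
  using assms by (simp add: Theta_inv_def the_inv_into_f_f inj_on_Theta)

lemma Theta_inv_SomeD:
  assumes "Theta_inv n p = Some X" "n > 0"
  shows "X \<in> T1 n" "p = Theta n X"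
  using assms inj_on_Theta[of n]
  by (auto simp: Theta_inv_def the_inv_into_f_f split: if_splits)

lemma Theta_in_XX:
  assumes X: "X \<in> T1 n"
  shows "Theta n X \<in> XX n (n - 1)"
proof -
  have "Theta_mat n X \<in> carrier_mat n (n - 1) \<and> vec_space.rank n (Theta_mat n X) = n - 1"
    using indep_cols_Theta_mat[OF X] rank_eq_iff_indep_cols[OF Theta_mat_carrier, of n X]
      Theta_mat_carrier[of n X] by simp
  then show ?thesis
    unfolding Theta_def XX_def Gr_def Theta_mat_def[symmetric]
    using X1_nonzero[OF X, of n] by blast
qed

section \<open>Pluecker coordinates and the matrix \<open>g\<close>\<close>

text \<open>
  The scalar \<open>c\<close> depends on the spanning matrix that is chosen for the subspace; it cancels in all
  quotients.
\<close>

lemma plucker_Theta: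
  assumes X: "X \<in> T1 n" and n: "n > 0"
  obtains c where "c \<noteq> 0"
    "\<And>J r. r < n \<Longrightarrow> row_set n J = {..<n} - {r} \<Longrightarrow> plucker n (n - 1) (fst (Theta n X)) J = c * X1 X r"
proof -
  let ?N = "fst (Theta n X)"
  define A where "A = spanning_mat n (n - 1) ?N"
  have "\<exists>A. A \<in> carrier_mat n (n - 1) \<and> vec_space.rank n A = n - 1 \<and> vec_space.col_space n A = ?N"
    using Theta_in_XX[OF X] by (auto simp: XX_def Gr_def mem_Times_iff)
  then have A: "A \<in> carrier_mat n (n - 1)" "vec_space.rank n A = n - 1" "vec_space.col_space n A = ?N"
    unfolding A_def spanning_mat_def by (rule someI2_ex; blast)+
  have nz: "alternating n (X1 X) \<noteq> 0\<^sub>v n" using n by (intro alternating_nonzero[of _ 0]) auto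
  have "vec_space.col_space n A = hyperplane n (alternating n (X1 X))"
    using A(3) by (simp add: Theta_eq_hyperplane[OF X n])
  from maximal_minors_proportional[OF A(1) _ this _ nz n] A(2) rank_eq_iff_indep_cols[OF A(1)]
  obtain c where c: "c \<noteq> 0" "\<And>r. r < n \<Longrightarrow> det (submatrix A ({..<n} - {r}) UNIV)
      = c * ((-1) ^ r * alternating n (X1 X) $ r)" by auto
  show thesis
  proof (rule that[OF c(1)])
    fix J r assume r: "r < n" and J: "row_set n J = {..<n} - {r}"
    show "plucker n (n - 1) (fst (Theta n X)) J = c * X1 X r"
      using r c(2)[OF r] unfolding plucker_def J A_def[symmetric]
      by (simp add: alternating_def mult.assoc[symmetric] power_mult_distrib[symmetric])
  qed
qed

text \<open>
  On a window of \<open>n\<close> consecutive integers reduction modulo \<open>n\<close> is injective, and the residue \<open>r\<close>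
  comes from the unique representative in the window that ends at library index \<open>a\<close>.
\<close>

lemma row_set_window:
  assumes a: "a < n" and J: "J \<subseteq> {int a + 2 - int n..int a + 1}"
  shows "row_set n J = {r. r < n \<and> (if r \<le> a then int r + 1 else int r + 1 - int n) \<in> J}"
    (is "_ = {r. r < n \<and> ?m r \<in> J}")
proof (intro Set.set_eqI iffI)
  fix r assume "r \<in> row_set n J"
  then obtain m where m: "m \<in> J" "r = nat ((m - 1) mod int n)" by (auto simp: row_set_def)
  have b: "int a + 2 - int n \<le> m" "m \<le> int a + 1" using m(1) J by auto
  have "r < n \<and> ?m r = m"
  proof (cases "m \<ge> 1")
    case True
    then have "(m - 1) mod int n = m - 1" using a b by (intro mod_pos_pos_trivial) linarith+
    then have "int r = m - 1" using m True by simp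
    then show ?thesis using b a by simp
  next
    case False
    have "(m - 1) mod int n = (m - 1 + int n) mod int n" by simp
    also have "\<dots> = m - 1 + int n" using a b False by (intro mod_pos_pos_trivial) linarith+
    finally have "int r = m - 1 + int n" using m a b by simp
    then show ?thesis using b a False by simp
  qed
  then show "r \<in> {r. r < n \<and> ?m r \<in> J}" using m(1) by simp
next
  fix r assume "r \<in> {r. r < n \<and> ?m r \<in> J}"
  then have r: "r < n" "?m r \<in> J" by blast+
  have "(int r - int n) mod int n = int r mod int n" by (rule minus_mod_self2)
  then have "r = nat ((?m r - 1) mod int n)" using r(1) by simp
  then show "r \<in> row_set n J" unfolding row_set_def by (rule image_eqI[OF _ r(2)])
qed

lemma row_set_interval:
  assumes a: "a < n"
  shows "row_set n {int a + 1 - int (n - 1)..int a + 1 - 1} = {..<n} - {a}"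
proof -
  have k: "int (n - 1) = int n - 1" using a by simp
  have "{int a + 1 - int (n - 1)..int a + 1 - 1} \<subseteq> {int a + 2 - int n..int a + 1}"
    unfolding k by simp
  note w = row_set_window[OF a this]
  have "(if r \<le> a then int r + 1 else int r + 1 - int n) \<in> {int a + 1 - int (n - 1)..int a + 1 - 1}
      \<longleftrightarrow> r \<noteq> a" if "r < n" for r
    unfolding k atLeastAtMost_iff using that a by (cases "r \<le> a"; auto)
  then show ?thesis unfolding w by blast
qed

lemma row_set_exchange:
  assumes a: "a < n" and i: "i < n" and n: "n \<ge> 2"
  shows "row_set n ({int a + 1 - int (n - 1) + 1..int a + 1 - 1} \<union> {int i + 1})
    = insert i ({..<n} - {a, Suc a mod n})"
proof -
  have k: "int (n - 1) = int n - 1" using n by simp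
  have s: "Suc a mod n = (if Suc a = n then 0 else Suc a)" using a by simp
  have ins: "row_set n (J \<union> {int i + 1}) = insert i (row_set n J)" for J
    using i by (simp add: row_set_def)
  have "{int a + 1 - int (n - 1) + 1..int a + 1 - 1} \<subseteq> {int a + 2 - int n..int a + 1}"
    unfolding k by simp
  note w = row_set_window[OF a this]
  have "(if r \<le> a then int r + 1 else int r + 1 - int n) \<in> {int a + 1 - int (n - 1) + 1..int a + 1 - 1}
      \<longleftrightarrow> r \<noteq> a \<and> r \<noteq> Suc a mod n" if "r < n" for r
    unfolding k atLeastAtMost_iff s using that a n by (cases "r \<le> a"; cases "Suc a = n"; auto)
  then have "row_set n {int a + 1 - int (n - 1) + 1..int a + 1 - 1} = {..<n} - {a, Suc a mod n}"
    unfolding w by blast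
  then show ?thesis unfolding ins by simp
qed

text \<open>
  The value of \<open>g\<close> at \<open>Theta n X\<close>: the bidiagonal matrix closed up cyclically by the indeterminate.
  For \<open>k = n - 1\<close> the index set in the numerator of an entry omits two residues, and its Pluecker
  coordinate vanishes, unless the row index equals the column index or its cyclic successor.
\<close>

definition Lax :: "nat \<Rightarrow> complex vec \<Rightarrow> complex poly mat" where
  "Lax n X = mat n n (\<lambda>(i, j).
     if i = j then [:coord n X (int i + 1):] else if i = Suc j then 1
     else if i = 0 \<and> j = n - 1 then [:0, 1:] else 0)"

lemma Lax_carrier [simp]: "Lax n X \<in> carrier_mat n n"
  by (simp add: Lax_def)

lemma g_Theta:
  assumes X: "X \<in> T1 n" and n: "n \<ge> 2"
  shows "g n (n - 1) (Theta n X) = Some (Lax n X)"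
proof -
  obtain c where c: "c \<noteq> 0" "\<And>J r. r < n \<Longrightarrow> row_set n J = {..<n} - {r} \<Longrightarrow>
      plucker n (n - 1) (fst (Theta n X)) J = c * X1 X r"
    using plucker_Theta[OF X] n by (metis less_le_trans pos2)
  have denom: "plucker n (n - 1) (fst (Theta n X)) {int a + 1 - int (n - 1)..int a + 1 - 1} = c * X1 X a"
    if "a < n" for a
    using that by (intro c(2) row_set_interval)
  have nz: "plucker n (n - 1) (fst (Theta n X)) {j - int (n - 1)..j - 1} \<noteq> 0"
    if "j \<in> {1..int n}" for j
  proof -
    define a where "a = nat (j - 1)"
    have "a < n" "j = int a + 1" using that by (auto simp: a_def)
    then show ?thesis using denom[of a] c(1) X1_nonzero[OF X, of a] by simp
  qed
  have num: "plucker n (n - 1) (fst (Theta n X))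
      ({int a + 1 - int (n - 1) + 1..int a + 1 - 1} \<union> {int i + 1})
      = (if i = a then c * X1 X (Suc a mod n) else if i = Suc a mod n then c * X1 X a else 0)"
    if ai: "a < n" "i < n" for a i
  proof -
    have ne: "Suc a mod n \<noteq> a" using ai n by (auto simp: mod_Suc)
    have lt: "Suc a mod n < n" using n by simp
    consider "i = a" | "i = Suc a mod n" "i \<noteq> a" | "i \<noteq> a" "i \<noteq> Suc a mod n" by blast
    then show ?thesis
    proof cases
      case 1
      then have "insert i ({..<n} - {a, Suc a mod n}) = {..<n} - {Suc a mod n}" using ai ne by auto
      from c(2)[OF lt trans[OF row_set_exchange[OF ai n] this]] 1 show ?thesis by simp
    next
      case 2
      then have "insert i ({..<n} - {a, Suc a mod n}) = {..<n} - {a}" using ai ne by auto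
      from c(2)[OF ai(1) trans[OF row_set_exchange[OF ai n] this]] 2 show ?thesis by simp
    next
      case 3
      then have "insert i ({..<n} - {a, Suc a mod n}) = {..<n} - {a, Suc a mod n}" using ai by auto
      moreover have "card ({..<n} - {a, Suc a mod n}) = n - 2"
        using ai ne lt by (subst card_Diff_subset) auto
      ultimately show ?thesis
        using 3 n unfolding plucker_def row_set_exchange[OF ai n] by simp
    qed
  qed
  have entry: "g_entry n (n - 1) (Theta n X) (int i + 1) (int a + 1) = Lax n X $$ (i, a)"
    if ai: "i < n" "a < n" for i a
  proof -
    have xa: "X1 X a \<noteq> 0" "X1 X n \<noteq> 0" using X1_nonzero[OF X] ai by auto
    have t: "snd (Theta n X) = X1 X n" by (simp add: Theta_def)
    show ?thesis
    \<comment> \<open>In the last column the cyclic successor wraps around, and the factor \<open>X1 X n\<close> turns the quotient of the first by the last Pluecker coordinate into \<open>x\<^sub>n\<close>.\<close>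
    proof (cases "Suc a = n")
      case True
      then show ?thesis
        unfolding g_entry_def num[OF ai(2,1)] denom[OF ai(2)] t
        using ai n xa c(1) by (auto simp: g_coeff_def Lax_def coord_Suc)
    next
      case False
      then have "Suc a mod n = Suc a" using ai by simp
      then show ?thesis
        unfolding g_entry_def num[OF ai(2,1)] denom[OF ai(2)] t
        using False ai n xa c(1) by (auto simp: g_coeff_def Lax_def coord_Suc)
    qed
  qed
  have "mat n n (\<lambda>(i, j). g_entry n (n - 1) (Theta n X) (int i + 1) (int j + 1)) = Lax n X"
    using entry by (intro eq_matI) (auto simp: Lax_def)
  then show ?thesis using nz Theta_in_XX[OF X] by (simp add: g_def)
qed

section \<open>The functions \<open>\<kappa>\<^sub>j\<close>\<close>

lemma prod_shift_int:
  fixes f :: "int \<Rightarrow> 'a::comm_monoid_mult"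
  shows "(\<Prod>i\<in>{a + d..b + d}. f i) = (\<Prod>i\<in>{a..b}. f (i + d))"
  by (rule prod.reindex_bij_witness[of _ "\<lambda>i. i + d" "\<lambda>i. i - d"]) auto

lemma prod_reflect_int:
  fixes f :: "int \<Rightarrow> 'a::comm_monoid_mult"
  shows "(\<Prod>i\<in>{a..b}. f (d - i)) = (\<Prod>i\<in>{d - b..d - a}. f i)"
  by (rule prod.reindex_bij_witness[of _ "\<lambda>i. d - i" "\<lambda>i. d - i"]) auto

lemma prod_periodic_window:
  fixes f :: "int \<Rightarrow> 'a::comm_monoid_mult"
  assumes per: "\<And>i. f (i + int n) = f i" and n: "n > 0"
  shows "(\<Prod>i\<in>{j + 1..j + int n}. f i) = (\<Prod>i\<in>{1..int n}. f i)"
proof -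
  have step: "(\<Prod>i\<in>{j + 1 + 1..j + 1 + int n}. f i) = (\<Prod>i\<in>{j + 1..j + int n}. f i)" for j
  proof -
    have "{j + 1 + 1..j + 1 + int n} = insert (j + 1 + int n) {j + 2..j + int n}"
      "{j + 1..j + int n} = insert (j + 1) {j + 2..j + int n}"
      using n by auto
    then show ?thesis using per[of "j + 1"] by simp
  qed
  show ?thesis
  proof (induction j rule: int_induct[of _ 0])
    case (step1 j)
    then show ?case using step[of j] by simp
  next
    case (step2 j)
    then show ?case using step[of "j - 1"] by simp
  qed simp
qed

lemma sum_int_interval: "(\<Sum>s\<in>{0..int n - 1}. f s) = (\<Sum>s<n. f (int s))"
  by (rule sum.reindex_bij_witness[of _ int nat]) auto

text \<open>
  Let \<open>A\<^sub>s = y\<^sub>j \<cdots> y\<^bsub>j+s-1\<^esub> x\<^bsub>j+s+1\<^esub> \<cdots> x\<^bsub>j+n\<^esub>\<close>. The two products on the left are \<open>A\<^sub>0 + \<cdots> + A\<^bsub>n-1\<^esub>\<close> and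
  \<open>A\<^sub>1 + \<cdots> + A\<^sub>n\<close>, so their difference telescopes to \<open>A\<^sub>0 - A\<^sub>n\<close>.
\<close>

lemma kappa_recurrence:
  assumes per: "\<And>i. x (i + int n) = x i" and n: "n > 0"
  shows "x j * kappa n x y j - y j * kappa n x y (j + 1)
    = (\<Prod>i\<in>{j + 1..j + int n}. x i) - (\<Prod>i\<in>{j..j + int n - 1}. y i)"
proof -
  \<comment> \<open>The factor \<open>x j\<close> enters as \<open>x (j + n)\<close>, by periodicity.\<close>
  define A where "A s = (\<Prod>i\<in>{j..j + int s - 1}. y i) * (\<Prod>i\<in>{j + int s + 1..j + int n}. x i)" for s
  have "x j * kappa n x y j = (\<Sum>s<n. A s)"
    unfolding kappa_def sum_int_interval sum_distrib_left
  proof (rule sum.cong[OF refl])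
    fix s assume "s \<in> {..<n}"
    then have "{j + int s + 1..j + int n} = insert (j + int n) {j + int s + 1..j + int n - 1}" by auto
    then show "x j * ((\<Prod>i\<in>{j..j + int s - 1}. y i) * (\<Prod>i\<in>{j + int s + 1..j + int n - 1}. x i)) = A s"
      unfolding A_def by (simp add: per)
  qed
  moreover have "y j * kappa n x y (j + 1) = (\<Sum>s<n. A (Suc s))"
    unfolding kappa_def sum_int_interval sum_distrib_left
  proof (rule sum.cong[OF refl])
    fix s assume "s \<in> {..<n}"
    have "{j..j + int (Suc s) - 1} = insert j {j + 1..j + 1 + int s - 1}" by auto
    moreover have "{j + int (Suc s) + 1..j + int n} = {j + 1 + int s + 1..j + 1 + int n - 1}" by auto
    ultimately show "y j * ((\<Prod>i\<in>{j + 1..j + 1 + int s - 1}. y i)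
        * (\<Prod>i\<in>{j + 1 + int s + 1..j + 1 + int n - 1}. x i)) = A (Suc s)"
      unfolding A_def by simp
  qed
  ultimately have "x j * kappa n x y j - y j * kappa n x y (j + 1) = A 0 - A n"
    using sum_lessThan_telescope'[of A n] by (simp add: sum_subtractf)
  then show ?thesis by (simp add: A_def)
qed

lemma kappa_periodic:
  assumes "\<And>i. x (i + int n) = x i" "\<And>i. y (i + int n) = y i"
  shows "kappa n x y (j + int n) = kappa n x y j"
  unfolding kappa_def
proof (rule sum.cong[OF refl])
  fix s
  have "(\<Prod>i\<in>{j + int n..j + int n + s - 1}. y i) = (\<Prod>i\<in>{j..j + s - 1}. y i)"
    using prod_shift_int[of y j "int n" "j + s - 1"] by (simp add: assms algebra_simps)
  moreover have "(\<Prod>i\<in>{j + int n + s + 1..j + int n + int n - 1}. x i) = (\<Prod>i\<in>{j + s + 1..j + int n - 1}. x i)"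
    using prod_shift_int[of x "j + s + 1" "int n" "j + int n - 1"] by (simp add: assms algebra_simps)
  ultimately show "(\<Prod>i\<in>{j + int n..j + int n + s - 1}. y i) * (\<Prod>i\<in>{j + int n + s + 1..j + int n + int n - 1}. x i)
      = (\<Prod>i\<in>{j..j + s - 1}. y i) * (\<Prod>i\<in>{j + s + 1..j + int n - 1}. x i)" by simp
qed

text \<open>
  Reflecting the indices and exchanging the two families sends the summand with \<open>s\<close> factors of one
  kind to the one with \<open>n - 1 - s\<close> factors of that kind.
\<close>

lemma kappa_reflect:
  assumes x: "\<And>i. x (i + int n) = x i" and y: "\<And>i. y (i + int n) = y i"
  shows "kappa n (\<lambda>i. y (int n + 1 - i)) (\<lambda>i. x (int n + 1 - i)) j = kappa n x y (int n + 2 - j)"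
  unfolding kappa_def
proof (rule sum.reindex_bij_witness[of _ "\<lambda>s. int n - 1 - s" "\<lambda>s. int n - 1 - s"])
  fix s assume "s \<in> {0..int n - 1}"
  let ?J = "int n + 2 - j"
  have "(\<Prod>i\<in>{j..j + s - 1}. x (int n + 1 - i)) = (\<Prod>i\<in>{?J - s..?J - 1}. x i)"
    unfolding prod_reflect_int by (simp add: algebra_simps)
  also have "\<dots> = (\<Prod>i\<in>{?J + (int n - 1 - s) + 1..?J + int n - 1}. x i)"
    using prod_shift_int[of x "?J - s" "int n" "?J - 1"] by (simp add: x algebra_simps)
  finally have 1: "(\<Prod>i\<in>{j..j + s - 1}. x (int n + 1 - i))
      = (\<Prod>i\<in>{?J + (int n - 1 - s) + 1..?J + int n - 1}. x i)" .
  have "(\<Prod>i\<in>{j + s + 1..j + int n - 1}. y (int n + 1 - i)) = (\<Prod>i\<in>{?J - int n..?J - 2 - s}. y i)"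
    unfolding prod_reflect_int by (simp add: algebra_simps)
  also have "\<dots> = (\<Prod>i\<in>{?J..?J + (int n - 1 - s) - 1}. y i)"
    using prod_shift_int[of y "?J - int n" "int n" "?J - 2 - s"] by (simp add: y algebra_simps)
  finally show "(\<Prod>i\<in>{?J..?J + (int n - 1 - s) - 1}. y i)
      * (\<Prod>i\<in>{?J + (int n - 1 - s) + 1..?J + int n - 1}. x i)
      = (\<Prod>i\<in>{j..j + s - 1}. x (int n + 1 - i)) * (\<Prod>i\<in>{j + s + 1..j + int n - 1}. y (int n + 1 - i))"
    using 1 by simp
qed auto

abbreviation kap :: "nat \<Rightarrow> complex vec \<Rightarrow> complex vec \<Rightarrow> int \<Rightarrow> complex" where
  "kap n X Y \<equiv> kappa n (coord n X) (coord n Y)"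

lemma kap_add_n: "kap n X Y (j + int n) = kap n X Y j"
  by (rule kappa_periodic) (rule coord_add_n)+

lemma kap_recurrence:
  assumes X: "X \<in> T1 n" and Y: "Y \<in> T1 n" and n: "n > 0"
  shows "coord n X j * kap n X Y j - coord n Y j * kap n X Y (j + 1) = X1 X n - X1 Y n"
proof -
  have "(\<Prod>i\<in>{j + 1..j + int n}. coord n X i) = X1 X n"
    using prod_periodic_window[of "coord n X", OF coord_add_n n] prod_coord[OF X] by simp
  moreover have "(\<Prod>i\<in>{j..j + int n - 1}. coord n Y i) = X1 Y n"
    using prod_periodic_window[of "coord n Y", OF coord_add_n n, of "j - 1"] prod_coord[OF Y]
    by (simp add: algebra_simps)
  ultimately show ?thesis
    using kappa_recurrence[of "coord n X", OF coord_add_n n, of j "coord n Y"] by simp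
qed

text \<open>
  In this form \<open>\<kappa>\<^sub>1\<close> becomes a multiple of the scalar product of the normal vector of \<open>Theta n Y\<close> with
  the vector with entries \<open>(-1)\<^sup>i / X\<^bsub>1,i+1\<^esub>\<close>, which spans the kernel of the cyclic matrix of \<open>X\<close>
  where that matrix is singular.
\<close>

lemma kap_1:
  assumes X: "X \<in> T1 n" and Y: "Y \<in> T1 n"
  shows "kap n X Y 1 = X1 X n * (\<Sum>i = 0..<n. X1 Y i / X1 X (Suc i))"
proof -
  have "(\<Prod>i\<in>{1..1 + int s - 1}. coord n Y i) * (\<Prod>i\<in>{1 + int s + 1..1 + int n - 1}. coord n X i)
      = X1 X n * (X1 Y s / X1 X (Suc s))" if s: "s < n" for s
  proof -
    have "{1..int n} = {1..int (Suc s)} \<union> {1 + int s + 1..1 + int n - 1}" using s by auto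
    then have "X1 X n = X1 X (Suc s) * (\<Prod>i\<in>{1 + int s + 1..1 + int n - 1}. coord n X i)"
      using prod_coord[OF X, of n] prod_coord[OF X, of "Suc s"] s
      by (simp add: prod.union_disjoint)
    then show ?thesis
      using X1_nonzero[OF X, of "Suc s"] prod_coord[OF Y, of s] s by simp
  qed
  then show ?thesis
    unfolding kappa_def sum_int_interval lessThan_atLeast0 sum_distrib_left by (intro sum.cong) auto
qed

lemma X1_vec: "m \<le> n \<Longrightarrow> X1 (vec n f) m = (if m = 0 then 1 else f (m - 1))"
  by (simp add: X1_def)

section \<open>The R-matrix on the torus\<close>

text \<open>
  The map \<open>x\<^sub>j \<mapsto> x\<^bsub>n+1-j\<^esub>\<close>, which is what \<open>S_map\<close> becomes on the torus.
\<close>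

definition torus_rev :: "nat \<Rightarrow> complex vec \<Rightarrow> complex vec" where
  "torus_rev n X = vec n (\<lambda>i. X1 X n / X1 X (n - 1 - i))"

lemma X1_torus_rev:
  assumes X: "X \<in> T1 n" and m: "m \<le> n"
  shows "X1 (torus_rev n X) m = X1 X n / X1 X (n - m)"
  using X1_nonzero[OF X, of n] m by (simp add: torus_rev_def X1_vec)

lemma torus_rev_T1:
  assumes X: "X \<in> T1 n"
  shows "torus_rev n X \<in> T1 n"
  using X1_nonzero[OF X] by (auto simp: T1_def torus_rev_def)

lemma coord_torus_rev:
  assumes X: "X \<in> T1 n" and n: "n > 0"
  shows "coord n (torus_rev n X) j = coord n X (int n + 1 - j)"
proof -
  define m where "m = nat ((j - 1) mod int n)"
  have m: "m < n" using n by (simp add: m_def nat_less_iff)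
  have im: "int m = (j - 1) mod int n" using n by (simp add: m_def)
  have "(int n + 1 - j - 1) mod int n = (int n - 1 - (j - 1) mod int n) mod int n"
    by (simp add: mod_diff_right_eq algebra_simps)
  also have "\<dots> = int n - 1 - int m" unfolding im[symmetric] using m by (intro mod_pos_pos_trivial) auto
  finally have "nat ((int n + 1 - j - 1) mod int n) = n - 1 - m" using m by simp
  then have "coord n X (int n + 1 - j) = X1 X (n - m) / X1 X (n - Suc m)"
    using m by (simp add: coord_def Let_def Suc_diff_Suc)
  moreover have "coord n (torus_rev n X) j = X1 (torus_rev n X) (Suc m) / X1 (torus_rev n X) m"
    by (simp add: coord_def Let_def m_def)
  ultimately show ?thesis
    using m X1_nonzero[OF X, of n] X1_nonzero[OF X, of "n - m"] by (simp add: X1_torus_rev[OF X])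
qed

lemma kap_torus_rev:
  assumes "X \<in> T1 n" "Y \<in> T1 n" "n > 0"
  shows "kap n (torus_rev n Y) (torus_rev n X) j = kap n X Y (int n + 2 - j)"
proof -
  have "coord n (torus_rev n Y) = (\<lambda>i. coord n Y (int n + 1 - i))"
    "coord n (torus_rev n X) = (\<lambda>i. coord n X (int n + 1 - i))"
    using assms by (auto simp: coord_torus_rev)
  then show ?thesis using kappa_reflect[of "coord n X" n "coord n Y", OF coord_add_n coord_add_n] by simp
qed

text \<open>
  The point with coordinates \<open>y\<^sub>j \<kappa>\<^bsub>j+1\<^esub> / \<kappa>\<^sub>j\<close>, the first component of the R-matrix. The quotients
  telescope in the products \<open>Y\<^sub>1\<^sub>m\<close>.
\<close>

definition swap_first :: "nat \<Rightarrow> complex vec \<Rightarrow> complex vec \<Rightarrow> complex vec" where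
  "swap_first n X Y = vec n (\<lambda>i. X1 Y (Suc i) * kap n X Y (int i + 2) / kap n X Y 1)"

lemma X1_swap_first:
  assumes k: "kap n X Y 1 \<noteq> 0" and m: "m \<le> n"
  shows "X1 (swap_first n X Y) m = X1 Y m * kap n X Y (int m + 1) / kap n X Y 1"
proof (cases m)
  case 0
  then show ?thesis using k by simp
next
  case (Suc i)
  have "1 + int m = int i + 2" using Suc by simp
  then show ?thesis using Suc m by (simp add: swap_first_def X1_vec add_ac)
qed

lemma kap_nonzero_upto:
  assumes "\<forall>j\<in>{1..int n}. kap n X Y j \<noteq> 0" "j \<in> {1..int n + 1}" "n > 0"
  shows "kap n X Y j \<noteq> 0"
proof (cases "j = int n + 1")
  case True
  then show ?thesis using assms kap_add_n[of n X Y 1] by (simp add: add.commute)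
qed (use assms in auto)

lemma swap_first_T1:
  assumes Y: "Y \<in> T1 n" and k: "\<forall>j\<in>{1..int n}. kap n X Y j \<noteq> 0"
  shows "swap_first n X Y \<in> T1 n"
  using X1_nonzero[OF Y] kap_nonzero_upto[OF k] by (auto simp: T1_def swap_first_def)

lemma X1_swap_first_n:
  assumes "kap n X Y 1 \<noteq> 0"
  shows "X1 (swap_first n X Y) n = X1 Y n"
  using X1_swap_first[OF assms order_refl] kap_add_n[of n X Y 1] assms by (simp add: add.commute)

lemma coord_swap_first:
  assumes Y: "Y \<in> T1 n" and k: "\<forall>j\<in>{1..int n}. kap n X Y j \<noteq> 0" and j: "j \<in> {1..int n}"
  shows "coord n (swap_first n X Y) j = coord n Y j * (kap n X Y (j + 1) / kap n X Y j)"
proof -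
  define i where "i = nat (j - 1)"
  have i: "i < n" "j = int i + 1" using j by (auto simp: i_def)
  have k1: "kap n X Y 1 \<noteq> 0" using k i by auto
  have "coord n (swap_first n X Y) j = X1 (swap_first n X Y) (Suc i) / X1 (swap_first n X Y) i"
    using i coord_Suc by simp
  also have "\<dots> = X1 Y (Suc i) * kap n X Y (j + 1) / (X1 Y i * kap n X Y j)"
    using i k1 by (simp add: X1_swap_first[OF k1] add_ac)
  also have "\<dots> = coord n Y j * (kap n X Y (j + 1) / kap n X Y j)"
    using i coord_Suc[of i n Y] by simp
  finally show ?thesis .
qed

section \<open>Products of two cyclic bidiagonal matrices\<close>

lemma eval_mat_carrier [simp]: "A \<in> carrier_mat n m \<Longrightarrow> eval_mat c A \<in> carrier_mat n m"
  by (simp add: eval_mat_def)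

lemma eval_mat_mult:
  assumes A: "A \<in> carrier_mat n m" and B: "B \<in> carrier_mat m p"
  shows "eval_mat c (A * B) = eval_mat c A * eval_mat c B"
  using A B by (intro eq_matI) (auto simp: eval_mat_def scalar_prod_def poly_sum)

lemma first_cols_mult:
  fixes A :: "complex mat"
  assumes A: "A \<in> carrier_mat n m" and B: "B \<in> carrier_mat m p" and k: "k \<le> p"
  shows "first_cols k (A * B) = A * first_cols k B"
  using A B k by (intro eq_matI) (auto simp: first_cols_def scalar_prod_def)

lemma first_cols_eval_Lax: "first_cols (n - 1) (eval_mat c (Lax n X)) = Theta_mat n X"
  by (intro eq_matI) (auto simp: first_cols_def eval_mat_def Lax_def Theta_mat_def bidiag_mat_def)

lemma eval_Lax_index:
  assumes "i < n" "j < n"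
  shows "eval_mat c (Lax n X) $$ (i, j) = (if i = j then coord n X (int i + 1)
    else if i = Suc j then 1 else if i = 0 \<and> j = n - 1 then c else 0)"
  using assms by (auto simp: eval_mat_def Lax_def)

text \<open>
  The sign in the evaluation of \<open>\<lambda>\<close> is chosen such that \<open>Lax n X\<close> becomes singular at
  \<open>t = X1 X n\<close>.
\<close>

abbreviation spectral :: "nat \<Rightarrow> complex \<Rightarrow> complex" where
  "spectral n t \<equiv> (-1) ^ (n - 1 - 1) * t"

text \<open>
  The condition on \<open>a n\<close> continues the sequence quasi-periodically, with multiplier \<open>t\<close>; the corner
  entry then fits into the same formula as the entries below the diagonal.
\<close>

lemma Lax_transpose_alternating:
  assumes n: "n \<ge> 2" and j: "j < n" and a: "a n = t * a 0"
  shows "((eval_mat (spectral n t) (Lax n X))\<^sup>T *\<^sub>v alternating n a) $ j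
    = (-1) ^ j * (coord n X (int j + 1) * a j - a (Suc j))"
proof -
  let ?L = "eval_mat (spectral n t) (Lax n X)"
  have L: "?L \<in> carrier_mat n n" by simp
  have "(?L\<^sup>T *\<^sub>v alternating n a) $ j = (\<Sum>i = 0..<n. ?L $$ (i, j) * ((-1) ^ i * a i))"
    using j carrier_matD[OF L] by (simp add: scalar_prod_def alternating_def)
  also have "\<dots> = (-1) ^ j * (coord n X (int j + 1) * a j - a (Suc j))"
  proof (cases "j = n - 1")
    case False
    have "(\<Sum>i = 0..<n. ?L $$ (i, j) * ((-1) ^ i * a i))
        = ?L $$ (j, j) * ((-1) ^ j * a j) + ?L $$ (Suc j, j) * ((-1) ^ Suc j * a (Suc j))"
      using False j by (intro sum_two_terms) (auto simp: eval_Lax_index)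
    then show ?thesis using False j by (simp add: eval_Lax_index algebra_simps)
  next
    case True
    have sp: "spectral n t = - ((-1) ^ j * t)" using True n by (cases "n - 1") auto
    have "(\<Sum>i = 0..<n. ?L $$ (i, j) * ((-1) ^ i * a i))
        = ?L $$ (j, j) * ((-1) ^ j * a j) + ?L $$ (0, j) * ((-1) ^ 0 * a 0)"
      using True n by (intro sum_two_terms) (auto simp: eval_Lax_index)
    also have "?L $$ (j, j) = coord n X (int j + 1)" using j by (simp add: eval_Lax_index)
    also have "?L $$ (0, j) = spectral n t" using True j n by (subst eval_Lax_index) auto
    also have "coord n X (int j + 1) * ((-1) ^ j * a j) + spectral n t * ((-1) ^ 0 * a 0)
        = (-1) ^ j * (coord n X (int j + 1) * a j - t * a 0)"
      unfolding sp by (simp add: algebra_simps)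
    also have "t * a 0 = a (Suc j)" using True n a by simp
    finally show ?thesis .
  qed
  finally show ?thesis .
qed

text \<open>
  The first \<open>n - 1\<close> columns of \<open>g (Theta n X) g (Theta n Y)\<close> at the value of \<open>\<lambda>\<close> prescribed by \<open>Y\<close>;
  the right factor loses its only column that contains \<open>\<lambda>\<close>.
\<close>

definition prod_mat :: "nat \<Rightarrow> complex vec \<Rightarrow> complex vec \<Rightarrow> complex mat" where
  "prod_mat n X Y = eval_mat (spectral n (X1 Y n)) (Lax n X) * Theta_mat n Y"

lemma prod_mat_carrier [simp]: "prod_mat n X Y \<in> carrier_mat n (n - 1)"
  unfolding prod_mat_def
  by (rule mult_carrier_mat[OF eval_mat_carrier[OF Lax_carrier] Theta_mat_carrier])

lemma prod_mat_vec:
  "b \<in> carrier_vec (n - 1) \<Longrightarrow>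
    prod_mat n X Y *\<^sub>v b = eval_mat (spectral n (X1 Y n)) (Lax n X) *\<^sub>v (Theta_mat n Y *\<^sub>v b)"
  unfolding prod_mat_def
  by (rule assoc_mult_mat_vec[OF eval_mat_carrier[OF Lax_carrier] Theta_mat_carrier])

definition normal_vec :: "nat \<Rightarrow> complex vec \<Rightarrow> complex vec \<Rightarrow> complex vec" where
  "normal_vec n X Y = alternating n (\<lambda>i. X1 Y i * kap n X Y (int i + 1))"

text \<open>
  By the recurrence for \<open>\<kappa>\<close>, applying the transpose of the left factor to \<open>normal_vec n X Y\<close> yields a
  multiple of the normal vector of \<open>Theta n Y\<close>, which annihilates the right factor.
\<close>

lemma normal_prod_mat:
  assumes X: "X \<in> T1 n" and Y: "Y \<in> T1 n" and n: "n \<ge> 2" and b: "b \<in> carrier_vec (n - 1)"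
  shows "normal_vec n X Y \<bullet> (prod_mat n X Y *\<^sub>v b) = 0"
proof -
  let ?L = "eval_mat (spectral n (X1 Y n)) (Lax n X)"
  \<comment> \<open>Periodicity of \<open>\<kappa>\<close> makes this sequence quasi-periodic with multiplier \<open>X1 Y n\<close>.\<close>
  let ?a = "\<lambda>i. X1 Y i * kap n X Y (int i + 1)"
  have L: "?L \<in> carrier_mat n n" by simp
  have an: "?a n = X1 Y n * ?a 0" using kap_add_n[of n X Y 1] by (simp add: add.commute)
  have "?L\<^sup>T *\<^sub>v normal_vec n X Y = (X1 X n - X1 Y n) \<cdot>\<^sub>v alternating n (X1 Y)"
  proof (rule eq_vecI)
    fix j assume "j < dim_vec ((X1 X n - X1 Y n) \<cdot>\<^sub>v alternating n (X1 Y))"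
    then have j: "j < n" by (simp add: alternating_def)
    have "(?L\<^sup>T *\<^sub>v normal_vec n X Y) $ j = (-1) ^ j * (coord n X (int j + 1) * ?a j - ?a (Suc j))"
      unfolding normal_vec_def by (rule Lax_transpose_alternating[OF n j an])
    also have "\<dots> = (-1) ^ j * X1 Y j *
        (coord n X (int j + 1) * kap n X Y (int j + 1) - coord n Y (int j + 1) * kap n X Y (int j + 1 + 1))"
      using X1_Suc[OF Y j] by (simp add: algebra_simps)
    also have "\<dots> = (-1) ^ j * X1 Y j * (X1 X n - X1 Y n)"
      using n by (subst kap_recurrence[OF X Y]) auto
    finally show "(?L\<^sup>T *\<^sub>v normal_vec n X Y) $ j = ((X1 X n - X1 Y n) \<cdot>\<^sub>v alternating n (X1 Y)) $ j"
      using j by (simp add: alternating_def)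
  qed (use carrier_matD[OF L] in \<open>simp add: alternating_def\<close>)
  moreover have "normal_vec n X Y \<bullet> (prod_mat n X Y *\<^sub>v b) = (?L\<^sup>T *\<^sub>v normal_vec n X Y) \<bullet> (Theta_mat n Y *\<^sub>v b)"
    unfolding prod_mat_vec[OF b]
    using transpose_vec_mult_scalar[OF L, of "Theta_mat n Y *\<^sub>v b" "normal_vec n X Y"] b
    by (simp add: normal_vec_def mult_mat_vec_carrier[OF Theta_mat_carrier])
  moreover have "Theta_mat n Y *\<^sub>v b \<in> carrier_vec n"
    using b by (simp add: mult_mat_vec_carrier[OF Theta_mat_carrier])
  ultimately show ?thesis
    using alternating_Theta_mat[OF Y b] by (simp add: smult_scalar_prod_distrib[of _ n])
qed

text \<open>
  All rows but the first determine a kernel vector from its first entry. The first row then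
  requires \<open>X1 X n = t\<close> unless the vector vanishes.
\<close>

lemma Lax_kernel_iff:
  assumes X: "X \<in> T1 n" and n: "n \<ge> 2" and z: "z \<in> carrier_vec n"
  shows "eval_mat (spectral n t) (Lax n X) *\<^sub>v z = 0\<^sub>v n \<longleftrightarrow>
    (\<exists>d. z = d \<cdot>\<^sub>v alternating n (\<lambda>i. 1 / X1 X (Suc i)) \<and> d * (X1 X n - t) = 0)"
proof -
  let ?L = "eval_mat (spectral n t) (Lax n X)"
  have L: "?L \<in> carrier_mat n n" by simp
  have row: "(?L *\<^sub>v z) $ i = (\<Sum>j = 0..<n. ?L $$ (i, j) * z $ j)" if "i < n" for i
    using that carrier_matD[OF L] z by (simp add: scalar_prod_def)
  have row_Suc: "(?L *\<^sub>v z) $ Suc i = coord n X (int (Suc i) + 1) * z $ Suc i + z $ i" if i: "Suc i < n" for i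
  proof -
    have "(\<Sum>j = 0..<n. ?L $$ (Suc i, j) * z $ j)
        = ?L $$ (Suc i, Suc i) * z $ Suc i + ?L $$ (Suc i, i) * z $ i"
      using i by (intro sum_two_terms) (auto simp: eval_Lax_index)
    then show ?thesis using row[OF i] i by (simp add: eval_Lax_index)
  qed
  have row_0: "(?L *\<^sub>v z) $ 0 = coord n X 1 * z $ 0 + spectral n t * z $ (n - 1)"
  proof -
    have "(\<Sum>j = 0..<n. ?L $$ (0, j) * z $ j)
        = ?L $$ (0, 0) * z $ 0 + ?L $$ (0, n - 1) * z $ (n - 1)"
      using n by (intro sum_two_terms) (auto simp: eval_Lax_index)
    then show ?thesis using row[of 0] n by (simp add: eval_Lax_index)
  qed
  have c1: "coord n X 1 = X1 X 1" using coord_Suc[of 0 n X] n by simp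
  have sp: "spectral n t * (-1) ^ (n - 1) = - t"
  proof -
    obtain m where "n = Suc (Suc m)" using n by (metis Suc_1 add_2_eq_Suc le_Suc_ex)
    then show ?thesis by (simp add: mult.commute power_mult_distrib[symmetric] mult.left_commute)
  qed
  have top: "(?L *\<^sub>v z) $ 0 = d * (X1 X n - t) / X1 X n"
    if "z = d \<cdot>\<^sub>v alternating n (\<lambda>i. 1 / X1 X (Suc i))" for d
  proof -
    have "z $ 0 = d / X1 X 1" "z $ (n - 1) = d * (-1) ^ (n - 1) / X1 X n"
      using that n by (simp_all add: alternating_def)
    then have "(?L *\<^sub>v z) $ 0 = d + d * (spectral n t * (-1) ^ (n - 1)) / X1 X n"
      unfolding row_0 c1 using X1_nonzero[OF X, of 1] n by simp
    then show ?thesis unfolding sp using X1_nonzero[OF X, of n] by (simp add: field_simps)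
  qed
  show ?thesis
  proof
    assume 0: "?L *\<^sub>v z = 0\<^sub>v n"
    define d where "d = z $ 0 * X1 X 1"
    \<comment> \<open>Row \<open>i + 1\<close> of the system reads \<open>x\<^bsub>i+2\<^esub> z\<^bsub>i+1\<^esub> + z\<^sub>i = 0\<close>, with rows and the entries of \<open>z\<close> numbered from \<open>0\<close>.\<close>
    have zi: "z $ i = d * ((-1) ^ i / X1 X (Suc i))" if "i < n" for i
      using that
    proof (induction i)
      case 0
      then show ?case using X1_nonzero[OF X, of 1] by (simp add: d_def)
    next
      case (Suc i)
      have nz: "X1 X (Suc i) \<noteq> 0" "X1 X (Suc (Suc i)) \<noteq> 0" using X1_nonzero[OF X] Suc.prems by auto
      have "coord n X (int (Suc i) + 1) * z $ Suc i + z $ i = 0"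
        using row_Suc[OF Suc.prems] 0 Suc.prems by simp
      then have "X1 X (Suc (Suc i)) / X1 X (Suc i) * z $ Suc i + d * ((-1) ^ i / X1 X (Suc i)) = 0"
        using Suc coord_Suc[OF Suc.prems, of X] by simp
      then have "X1 X (Suc (Suc i)) * z $ Suc i + d * (-1) ^ i = 0" using nz by (simp add: field_simps)
      then have "X1 X (Suc (Suc i)) * z $ Suc i = d * (-1) ^ Suc i" by (simp add: eq_neg_iff_add_eq_0)
      then show ?case using nz by (simp add: field_simps)
    qed
    have zd: "z = d \<cdot>\<^sub>v alternating n (\<lambda>i. 1 / X1 X (Suc i))"
      using z zi by (intro eq_vecI) (auto simp: alternating_def)
    have "d * (X1 X n - t) / X1 X n = 0" using top[OF zd] 0 n by simp
    then show "\<exists>d. z = d \<cdot>\<^sub>v alternating n (\<lambda>i. 1 / X1 X (Suc i)) \<and> d * (X1 X n - t) = 0"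
      using zd X1_nonzero[OF X, of n] by auto
  next
    assume "\<exists>d. z = d \<cdot>\<^sub>v alternating n (\<lambda>i. 1 / X1 X (Suc i)) \<and> d * (X1 X n - t) = 0"
    then obtain d where d: "z = d \<cdot>\<^sub>v alternating n (\<lambda>i. 1 / X1 X (Suc i))" "d * (X1 X n - t) = 0"
      by blast
    have "(?L *\<^sub>v z) $ i = 0" if i: "i < n" for i
    proof (cases i)
      case 0
      then show ?thesis using top[OF d(1)] d(2) by simp
    next
      case (Suc k)
      have "coord n X (int (Suc k) + 1) = X1 X (Suc (Suc k)) / X1 X (Suc k)"
        by (rule coord_Suc) (use i Suc in simp)
      then show ?thesis
        using row_Suc[of k] i Suc d(1) X1_nonzero[OF X, of "Suc k"] X1_nonzero[OF X, of "Suc (Suc k)"]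
        by (simp add: alternating_def)
    qed
    then show "?L *\<^sub>v z = 0\<^sub>v n" using carrier_matD[OF L] by (intro eq_vecI) (auto simp del: index_mult_mat_vec)
  qed
qed

lemma scalar_prod_kernel:
  assumes X: "X \<in> T1 n" and Y: "Y \<in> T1 n"
  shows "X1 X n * (alternating n (X1 Y) \<bullet> alternating n (\<lambda>i. 1 / X1 X (Suc i))) = kap n X Y 1"
proof -
  have "alternating n (X1 Y) \<bullet> alternating n (\<lambda>i. 1 / X1 X (Suc i)) = (\<Sum>i = 0..<n. X1 Y i / X1 X (Suc i))"
    unfolding scalar_prod_def
    by (auto simp: alternating_def power_mult_distrib[symmetric] intro!: sum.cong)
  then show ?thesis by (simp add: kap_1[OF X Y])
qed

text \<open>
  A kernel vector of the product gives a vector in the column space of \<open>Theta_mat n Y\<close> that the left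
  factor kills, hence a multiple of the explicit vector in \<open>Lax_kernel_iff\<close>. But \<open>\<kappa>\<^sub>1 \<noteq> 0\<close> says that
  this vector is not orthogonal to the normal vector of \<open>Theta n Y\<close>.
\<close>

lemma indep_cols_prod_mat_if:
  assumes X: "X \<in> T1 n" and Y: "Y \<in> T1 n" and n: "n \<ge> 2" and k: "kap n X Y 1 \<noteq> 0"
  shows "indep_cols n (prod_mat n X Y)"
  unfolding indep_cols_iff_injective[OF prod_mat_carrier]
proof (intro ballI impI)
  fix b :: "complex vec" assume b: "b \<in> carrier_vec (n - 1)" and 0: "prod_mat n X Y *\<^sub>v b = 0\<^sub>v n"
  let ?z = "Theta_mat n Y *\<^sub>v b" and ?v = "alternating n (\<lambda>i. 1 / X1 X (Suc i))"
  have z: "?z \<in> carrier_vec n" using b by (rule mult_mat_vec_carrier[OF Theta_mat_carrier])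
  obtain d where d: "?z = d \<cdot>\<^sub>v ?v"
    using 0 Lax_kernel_iff[OF X n z] unfolding prod_mat_vec[OF b] by blast
  have "d * (alternating n (X1 Y) \<bullet> ?v) = 0"
    using alternating_Theta_mat[OF Y b] unfolding d
    by (subst (asm) scalar_prod_smult_distrib[of _ n]) simp_all
  moreover have "alternating n (X1 Y) \<bullet> ?v \<noteq> 0" using scalar_prod_kernel[OF X Y] k by auto
  ultimately have "d = 0" by simp
  then have "?z = 0\<^sub>v n" using d by (intro eq_vecI) (auto simp: alternating_def)
  then show "b = 0\<^sub>v (n - 1)"
    using b indep_cols_Theta_mat[OF Y] unfolding indep_cols_iff_injective[OF Theta_mat_carrier] by blast
qed

text \<open>
  If both fail, the left factor is singular and its kernel lies in the column space of the right
  factor.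
\<close>

lemma indep_cols_prod_mat_imp:
  assumes X: "X \<in> T1 n" and Y: "Y \<in> T1 n" and n: "n \<ge> 2" and ind: "indep_cols n (prod_mat n X Y)"
  shows "kap n X Y 1 \<noteq> 0 \<or> X1 X n \<noteq> X1 Y n"
proof (rule ccontr)
  assume "\<not> ?thesis"
  then have k: "kap n X Y 1 = 0" and st: "X1 X n = X1 Y n" by auto
  let ?v = "alternating n (\<lambda>i. 1 / X1 X (Suc i))"
  have n0: "n > 0" using n by simp
  have "alternating n (X1 Y) \<bullet> ?v = 0" using scalar_prod_kernel[OF X Y] k X1_nonzero[OF X, of n] by simp
  then have "?v \<in> fst (Theta n Y)" unfolding Theta_eq_hyperplane[OF Y n0] by (simp add: hyperplane_def)
  then obtain b where b: "b \<in> carrier_vec (n - 1)" "?v = Theta_mat n Y *\<^sub>v b"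
    unfolding Theta_def Theta_mat_def[symmetric] col_space_range[OF Theta_mat_carrier] by auto
  have "prod_mat n X Y *\<^sub>v b = 0\<^sub>v n"
    unfolding prod_mat_vec[OF b(1)] b(2)[symmetric]
    using st by (subst Lax_kernel_iff[OF X n]) (auto intro!: exI[of _ 1])
  then have "b = 0\<^sub>v (n - 1)" using ind b unfolding indep_cols_iff_injective[OF prod_mat_carrier] by blast
  then have "?v = Theta_mat n Y *\<^sub>v 0\<^sub>v (n - 1)" using b(2) by simp
  also have "\<dots> = 0\<^sub>v n" using carrier_matD[OF Theta_mat_carrier[of n Y]] by (intro eq_vecI) (auto simp: scalar_prod_def)
  finally have "?v = 0\<^sub>v n" .
  moreover have "?v \<noteq> 0\<^sub>v n"
    using n0 X1_nonzero[OF X, of 1] by (intro alternating_nonzero[of _ 0]) auto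
  ultimately show False by simp
qed

lemma Psi_Theta:
  assumes X: "X \<in> T1 n" and Y: "Y \<in> T1 n" and n: "n \<ge> 2"
  shows "Psi n (n - 1) (n - 1) (Theta n X, Theta n Y) =
    (if indep_cols n (prod_mat n X Y) then Some (vec_space.col_space n (prod_mat n X Y), X1 Y n) else None)"
proof -
  have "first_cols (n - 1) (eval_mat (spectral n (X1 Y n)) (Lax n X * Lax n Y)) = prod_mat n X Y"
    unfolding prod_mat_def eval_mat_mult[OF Lax_carrier Lax_carrier]
    by (subst first_cols_mult[of _ n n _ n]) (auto simp: first_cols_eval_Lax[simplified])
  moreover have "snd (Theta n Y) = X1 Y n" by (simp add: Theta_def)
  ultimately show ?thesis
    unfolding Psi_def by (simp add: g_Theta[OF X n, simplified] g_Theta[OF Y n, simplified] proj_z_def Let_def)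
qed

lemma Psi_Theta_generic:
  assumes X: "X \<in> T1 n" and Y: "Y \<in> T1 n" and n: "n \<ge> 2"
    and k: "\<forall>j\<in>{1..int n}. kap n X Y j \<noteq> 0"
  shows "Psi n (n - 1) (n - 1) (Theta n X, Theta n Y) = Some (Theta n (swap_first n X Y))"
proof -
  have n0: "n > 0" and k1: "kap n X Y 1 \<noteq> 0" using n k by auto
  have nz: "normal_vec n X Y \<noteq> 0\<^sub>v n"
    unfolding normal_vec_def using n0 k1 by (intro alternating_nonzero[of _ 0]) auto
  have ind: "indep_cols n (prod_mat n X Y)" by (rule indep_cols_prod_mat_if[OF X Y n k1])
  have "vec_space.col_space n (prod_mat n X Y) = hyperplane n (normal_vec n X Y)"
    by (rule col_space_eq_hyperplane[OF prod_mat_carrier ind _ normal_prod_mat[OF X Y n] nz n0])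
      (simp add: normal_vec_def)
  also have "normal_vec n X Y = kap n X Y 1 \<cdot>\<^sub>v alternating n (X1 (swap_first n X Y))"
    using k1 by (intro eq_vecI) (auto simp: normal_vec_def alternating_def X1_swap_first)
  also have "hyperplane n \<dots> = hyperplane n (alternating n (X1 (swap_first n X Y)))"
    using k1 unfolding hyperplane_def by auto
  finally show ?thesis
    unfolding Psi_Theta[OF X Y n] Theta_eq_hyperplane[OF swap_first_T1[OF Y k] n0]
    using ind X1_swap_first_n[OF k1] by simp
qed

section \<open>The composite map\<close>

text \<open>
  The flip is the transposition along the antidiagonal: it reverses the diagonal and fixes the
  subdiagonal and the corner.
\<close>

lemma S_map_Theta:
  assumes X: "X \<in> T1 n" and n: "n \<ge> 2"
  shows "S_map n (n - 1) (Theta n X) = Some (Theta n (torus_rev n X))"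
proof -
  have "fl n (Lax n X) = Lax n (torus_rev n X)"
  proof (rule eq_matI)
    fix i j assume "i < dim_row (Lax n (torus_rev n X))" "j < dim_col (Lax n (torus_rev n X))"
    then have ij: "i < n" "j < n" by (auto simp: Lax_def)
    have "coord n (torus_rev n X) (int i + 1) = coord n X (int (n - 1 - i) + 1)"
      using ij n by (simp add: coord_torus_rev[OF X] of_nat_diff algebra_simps)
    moreover have "n - 1 - j = n - 1 - i \<longleftrightarrow> i = j" "n - 1 - j = Suc (n - 1 - i) \<longleftrightarrow> i = Suc j"
      "n - 1 - j = 0 \<and> n - 1 - i = n - 1 \<longleftrightarrow> i = 0 \<and> j = n - 1"
      using ij by auto
    moreover have "n - 1 - j < n" "n - 1 - i < n" using n by auto
    ultimately show "fl n (Lax n X) $$ (i, j) = Lax n (torus_rev n X) $$ (i, j)"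
      using ij unfolding fl_def Lax_def by auto
  qed (simp_all add: fl_def Lax_def)
  moreover have "snd (Theta n X) = X1 (torus_rev n X) n"
    using X1_torus_rev[OF X, of n] by (simp add: Theta_def)
  ultimately show ?thesis
    using indep_cols_Theta_mat[OF torus_rev_T1[OF X]] 
    unfolding S_map_def g_Theta[OF X n]
    by (simp add: proj_z_def Let_def first_cols_eval_Lax[simplified] Theta_def Theta_mat_def)
qed

text \<open>
  Every intermediate point of the composite is again in the image of \<open>Theta\<close>, because reversing both
  points and exchanging them only permutes the \<open>\<kappa>\<^sub>j\<close>.
\<close>

lemma ThetaR_generic:
  assumes X: "X \<in> T1 n" and Y: "Y \<in> T1 n" and n: "n \<ge> 2"
    and k: "\<forall>j\<in>{1..int n}. kap n X Y j \<noteq> 0"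
  shows "ThetaR n (X, Y) =
    Some (swap_first n X Y, torus_rev n (swap_first n (torus_rev n Y) (torus_rev n X)))"
proof -
  have n0: "n > 0" using n by simp
  note rX = torus_rev_T1[OF X] and rY = torus_rev_T1[OF Y]
  have k': "\<forall>j\<in>{1..int n}. kap n (torus_rev n Y) (torus_rev n X) j \<noteq> 0"
    unfolding kap_torus_rev[OF X Y n0] using kap_nonzero_upto[OF k] n0 by auto
  note sX = swap_first_T1[OF rX k']
  have "S_pair n (n - 1) (n - 1) (Theta n X, Theta n Y) = Some (Theta n (torus_rev n Y), Theta n (torus_rev n X))"
    unfolding S_pair_def by (simp add: S_map_Theta[OF X n, simplified] S_map_Theta[OF Y n, simplified])
  then have "R_map n (n - 1) (n - 1) (Theta n X, Theta n Y) = Some (Theta n (swap_first n X Y),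
      Theta n (torus_rev n (swap_first n (torus_rev n Y) (torus_rev n X))))"
    unfolding R_map_def Psi_Theta_generic[OF X Y n k]
    by (simp add: Psi_Theta_generic[OF rY rX n k', simplified] S_map_Theta[OF sX n, simplified])
  then show ?thesis
    unfolding ThetaR_def using Theta_inv_Theta[OF swap_first_T1[OF Y k] n0]
      Theta_inv_Theta[OF torus_rev_T1[OF sX] n0] by simp
qed

text \<open>
  If the first component lies in the image of \<open>Theta\<close>, then \<open>normal_vec n X Y\<close> is a multiple of a
  vector without zero entries, so either all \<open>\<kappa>\<^sub>j\<close> vanish or none does. If all of them vanish, the
  recurrence forces \<open>X1 X n = X1 Y n\<close>, and the columns of \<open>prod_mat n X Y\<close> are dependent.
\<close>

lemma ThetaR_SomeD:
  assumes X: "X \<in> T1 n" and Y: "Y \<in> T1 n" and n: "n \<ge> 2" and some: "ThetaR n (X, Y) = Some Z"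
  shows "\<forall>j\<in>{1..int n}. kap n X Y j \<noteq> 0"
proof -
  have n0: "n > 0" using n by simp
  obtain q W where q: "Psi n (n - 1) (n - 1) (Theta n X, Theta n Y) = Some q" "Theta_inv n q = Some W"
    using some unfolding ThetaR_def R_map_def by (auto simp: bind_eq_Some_conv)
  note W = Theta_inv_SomeD[OF q(2) n0]
  have ind: "indep_cols n (prod_mat n X Y)" and col: "fst q = vec_space.col_space n (prod_mat n X Y)"
    using q(1) unfolding Psi_Theta[OF X Y n] by (auto split: if_splits)
  have "hyperplane n (alternating n (X1 W)) \<subseteq> hyperplane n (normal_vec n X Y)"
  proof
    fix u assume "u \<in> hyperplane n (alternating n (X1 W))"
    then have u: "u \<in> carrier_vec n" "u \<in> vec_space.col_space n (prod_mat n X Y)"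
      using col W Theta_eq_hyperplane[OF W(1) n0] by (auto simp: hyperplane_def)
    then show "u \<in> hyperplane n (normal_vec n X Y)"
      using normal_prod_mat[OF X Y n] by (auto simp: hyperplane_def col_space_range[OF prod_mat_carrier])
  qed
  note sub = this
  have ratio: "X1 Y i * kap n X Y (int i + 1) = X1 W i * kap n X Y 1" if i: "i < n" for i
    using hyperplane_subset_imp_proportional[OF _ _ sub n0 i] i n0
    by (simp add: normal_vec_def alternating_def)
  have "kap n X Y 1 \<noteq> 0"
  proof
    assume k1: "kap n X Y 1 = 0"
    \<comment> \<open>The recurrence at \<open>j = n\<close> involves only \<open>\<kappa>\<^sub>n\<close> and \<open>\<kappa>\<^bsub>n+1\<^esub> = \<kappa>\<^sub>1\<close>.\<close>
    have "kap n X Y (int (n - 1) + 1) = 0"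
      using ratio[of "n - 1"] k1 n0 X1_nonzero[OF Y, of "n - 1"] by simp
    then have "X1 X n = X1 Y n"
      using kap_recurrence[OF X Y n0, of "int n"] k1 kap_add_n[of n X Y 1] n0
      by (simp add: of_nat_diff add.commute)
    then show False using indep_cols_prod_mat_imp[OF X Y n ind] k1 by simp
  qed
  moreover have "kap n X Y j \<noteq> 0" if "j \<in> {1..int n}" "kap n X Y 1 \<noteq> 0" for j
  proof -
    define i where "i = nat (j - 1)"
    have "i < n" "j = int i + 1" using that by (auto simp: i_def)
    then show ?thesis using ratio[of i] that X1_nonzero[OF W(1), of i] by auto
  qed
  ultimately show ?thesis by blast
qed

section \<open>Genericity\<close>

text \<open>
  The \<open>\<kappa>\<^sub>j\<close> are rational, not polynomial, in the entries of the points. Genericity asks for a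
  polynomial, so denominators that are invertible on the torus are cleared.
\<close>

definition rational_fun :: "nat \<Rightarrow> (complex vec \<times> complex vec \<Rightarrow> complex) \<Rightarrow> bool" where
  "rational_fun n f \<longleftrightarrow> (\<exists>F G. poly_fun n F \<and> poly_fun n G \<and>
     (\<forall>p \<in> T1 n \<times> T1 n. G p \<noteq> 0 \<and> f p * G p = F p))"

lemma rational_fun_const: "rational_fun n (\<lambda>p. c)"
  unfolding rational_fun_def
  by (rule exI[of _ "\<lambda>p. c"], rule exI[of _ "\<lambda>p. 1"]) (auto intro: poly_fun.const)

lemma rational_fun_add:
  assumes "rational_fun n f" "rational_fun n h"
  shows "rational_fun n (\<lambda>p. f p + h p)"
proof -
  obtain F G where 1: "poly_fun n F" "poly_fun n G" "\<forall>p \<in> T1 n \<times> T1 n. G p \<noteq> 0 \<and> f p * G p = F p"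
    using assms(1) unfolding rational_fun_def by blast
  obtain F' G' where 2: "poly_fun n F'" "poly_fun n G'" "\<forall>p \<in> T1 n \<times> T1 n. G' p \<noteq> 0 \<and> h p * G' p = F' p"
    using assms(2) unfolding rational_fun_def by blast
  have "poly_fun n (\<lambda>p. F p * G' p + F' p * G p)" "poly_fun n (\<lambda>p. G p * G' p)"
    using 1 2 by (auto intro: poly_fun.intros)
  moreover have "G p * G' p \<noteq> 0 \<and> (f p + h p) * (G p * G' p) = F p * G' p + F' p * G p"
    if "p \<in> T1 n \<times> T1 n" for p
  proof -
    have "F p = f p * G p" "F' p = h p * G' p" "G p \<noteq> 0" "G' p \<noteq> 0"
      using 1(3)[rule_format, OF that] 2(3)[rule_format, OF that] by auto
    then show ?thesis by (simp add: algebra_simps)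
  qed
  ultimately show ?thesis unfolding rational_fun_def by blast
qed

lemma rational_fun_mult:
  assumes "rational_fun n f" "rational_fun n h"
  shows "rational_fun n (\<lambda>p. f p * h p)"
proof -
  obtain F G where 1: "poly_fun n F" "poly_fun n G" "\<forall>p \<in> T1 n \<times> T1 n. G p \<noteq> 0 \<and> f p * G p = F p"
    using assms(1) unfolding rational_fun_def by blast
  obtain F' G' where 2: "poly_fun n F'" "poly_fun n G'" "\<forall>p \<in> T1 n \<times> T1 n. G' p \<noteq> 0 \<and> h p * G' p = F' p"
    using assms(2) unfolding rational_fun_def by blast
  have "poly_fun n (\<lambda>p. F p * F' p)" "poly_fun n (\<lambda>p. G p * G' p)"
    using 1 2 by (auto intro: poly_fun.intros)
  moreover have "G p * G' p \<noteq> 0 \<and> (f p * h p) * (G p * G' p) = F p * F' p"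
    if "p \<in> T1 n \<times> T1 n" for p
  proof -
    have "F p = f p * G p" "F' p = h p * G' p" "G p \<noteq> 0" "G' p \<noteq> 0"
      using 1(3)[rule_format, OF that] 2(3)[rule_format, OF that] by auto
    then show ?thesis by simp
  qed
  ultimately show ?thesis unfolding rational_fun_def by blast
qed

lemma rational_fun_sum:
  "(\<And>i. i \<in> I \<Longrightarrow> rational_fun n (f i)) \<Longrightarrow> rational_fun n (\<lambda>p. \<Sum>i\<in>I. f i p)"
  by (induction I rule: infinite_finite_induct) (auto intro: rational_fun_const rational_fun_add)

lemma rational_fun_prod:
  "(\<And>i. i \<in> I \<Longrightarrow> rational_fun n (f i)) \<Longrightarrow> rational_fun n (\<lambda>p. \<Prod>i\<in>I. f i p)"
  by (induction I rule: infinite_finite_induct) (auto intro: rational_fun_const rational_fun_mult)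

lemma poly_fun_X1:
  "m \<le> n \<Longrightarrow> poly_fun n (\<lambda>p. X1 (fst p) m)" "m \<le> n \<Longrightarrow> poly_fun n (\<lambda>p. X1 (snd p) m)"
  by (cases m; auto simp: X1_def intro: poly_fun.intros)+

lemma rational_fun_coord:
  assumes n: "n > 0"
  shows "rational_fun n (\<lambda>p. coord n (fst p) j)" "rational_fun n (\<lambda>p. coord n (snd p) j)"
proof -
  define m where "m = nat ((j - 1) mod int n)"
  have m: "m < n" using n by (simp add: m_def nat_less_iff)
  have c: "coord n X j = X1 X (Suc m) / X1 X m" for X by (simp add: coord_def m_def Let_def)
  have "\<forall>p \<in> T1 n \<times> T1 n. X1 (fst p) m \<noteq> 0 \<and> coord n (fst p) j * X1 (fst p) m = X1 (fst p) (Suc m)"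
    using m X1_nonzero by (auto simp: c)
  then show "rational_fun n (\<lambda>p. coord n (fst p) j)"
    unfolding rational_fun_def using m
    by (intro exI[of _ "\<lambda>p. X1 (fst p) (Suc m)"] exI[of _ "\<lambda>p. X1 (fst p) m"] conjI poly_fun_X1) simp_all
  have "\<forall>p \<in> T1 n \<times> T1 n. X1 (snd p) m \<noteq> 0 \<and> coord n (snd p) j * X1 (snd p) m = X1 (snd p) (Suc m)"
    using m X1_nonzero by (auto simp: c)
  then show "rational_fun n (\<lambda>p. coord n (snd p) j)"
    unfolding rational_fun_def using m
    by (intro exI[of _ "\<lambda>p. X1 (snd p) (Suc m)"] exI[of _ "\<lambda>p. X1 (snd p) m"] conjI poly_fun_X1) simp_all
qed

lemma generic_mono:
  assumes "generic n D" "\<And>p. p \<in> T1 n \<times> T1 n \<Longrightarrow> p \<in> D \<Longrightarrow> p \<in> E"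
  shows "generic n E"
  using assms unfolding generic_def by meson

text \<open>
  At the point where all coordinates are \<open>1\<close>, every \<open>\<kappa>\<^sub>j\<close> equals \<open>n\<close>.
\<close>

lemma generic_kap_nonzero:
  assumes n: "n > 0"
  shows "generic n {(X, Y). \<forall>j\<in>{1..int n}. kap n X Y j \<noteq> 0}"
proof -
  define f where "f p = (\<Prod>j\<in>{1..int n}. kap n (fst p) (snd p) j)" for p
  have "rational_fun n (\<lambda>p. \<Prod>j\<in>{1..int n}. kap n (fst p) (snd p) j)"
    unfolding kappa_def
    by (intro rational_fun_prod rational_fun_sum rational_fun_mult rational_fun_coord n)
  then have "rational_fun n f" by (simp add: f_def[abs_def])
  then obtain F G where F: "poly_fun n F" and FG: "\<forall>p \<in> T1 n \<times> T1 n. G p \<noteq> 0 \<and> f p * G p = F p"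
    unfolding rational_fun_def by blast
  have iff: "F p \<noteq> 0 \<longleftrightarrow> f p \<noteq> 0" if "p \<in> T1 n \<times> T1 n" for p
    using FG[rule_format, OF that] by auto
  \<comment> \<open>All products of coordinates of \<open>e\<close> are \<open>1\<close>.\<close>
  define e :: "complex vec" where "e = vec n (\<lambda>_. 1)"
  have "X1 e m = 1" if "m \<le> n" for m using that by (simp add: e_def X1_vec)
  moreover have "nat ((j - 1) mod int n) < n" for j using n by (simp add: nat_less_iff)
  ultimately have "coord n e j = 1" for j by (simp add: coord_def Let_def Suc_le_eq less_imp_le)
  then have "f (e, e) \<noteq> 0" using n by (simp add: f_def kappa_def)
  moreover have "(e, e) \<in> T1 n \<times> T1 n" by (simp add: e_def T1_def)
  ultimately have "\<exists>p \<in> T1 n \<times> T1 n. F p \<noteq> 0" using iff by blast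
  moreover have "\<forall>p \<in> T1 n \<times> T1 n. F p \<noteq> 0 \<longrightarrow> p \<in> {(X, Y). \<forall>j\<in>{1..int n}. kap n X Y j \<noteq> 0}"
    using iff by (auto simp: f_def)
  ultimately show ?thesis unfolding generic_def using F by blast
qed

section \<open>The coordinate formula\<close>

theorem proposition7p4:
  fixes n :: nat
  assumes "n \<ge> 2"
  shows "generic n (dom (ThetaR n)) \<and>
    (\<forall>X \<in> T1 n. \<forall>Y \<in> T1 n. \<forall>X' Y'. ThetaR n (X, Y) = Some (Y', X') \<longrightarrow>
      Y' \<in> T1 n \<and> X' \<in> T1 n \<and>
      (let x = coord n X; y = coord n Y; x' = coord n X'; y' = coord n Y'; \<kappa> = kappa n x y
       in \<forall>j \<in> {1..int n}.
            \<kappa> j \<noteq> 0 \<and> \<kappa> (j + 1) \<noteq> 0 \<and>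
            y' j = y j * (\<kappa> (j + 1) / \<kappa> j) \<and>
            x' j = x j * (\<kappa> j / \<kappa> (j + 1))))"
proof (intro conjI ballI allI impI)
  have n0: "n > 0" using assms by simp
  show "generic n (dom (ThetaR n))"
  proof (rule generic_mono[OF generic_kap_nonzero[OF n0]])
    fix p assume "p \<in> T1 n \<times> T1 n" "p \<in> {(X, Y). \<forall>j\<in>{1..int n}. kap n X Y j \<noteq> 0}"
    then show "p \<in> dom (ThetaR n)" using ThetaR_generic[OF _ _ assms] by (cases p) auto
  qed
  fix X Y X' Y' assume X: "X \<in> T1 n" and Y: "Y \<in> T1 n" and R: "ThetaR n (X, Y) = Some (Y', X')"
  let ?rX = "torus_rev n X" and ?rY = "torus_rev n Y"
  note rX = torus_rev_T1[OF X] and rY = torus_rev_T1[OF Y]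
  have k: "\<forall>j\<in>{1..int n}. kap n X Y j \<noteq> 0" by (rule ThetaR_SomeD[OF X Y assms R])
  have k': "\<forall>j\<in>{1..int n}. kap n ?rY ?rX j \<noteq> 0"
    unfolding kap_torus_rev[OF X Y n0] using kap_nonzero_upto[OF k] n0 by auto
  have Y': "Y' = swap_first n X Y" and X': "X' = torus_rev n (swap_first n ?rY ?rX)"
    using R ThetaR_generic[OF X Y assms k] by auto
  note s = swap_first_T1[OF rX k']
  show "Y' \<in> T1 n" unfolding Y' by (rule swap_first_T1[OF Y k])
  show "X' \<in> T1 n" unfolding X' by (rule torus_rev_T1[OF s])
  have x': "coord n X' j = coord n X j * (kap n X Y j / kap n X Y (j + 1))" if j: "j \<in> {1..int n}" for j
  proof -
    have "int n + 1 - j \<in> {1..int n}" using j by auto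
    from coord_swap_first[OF rX k' this] show ?thesis
      unfolding X' coord_torus_rev[OF s n0] kap_torus_rev[OF X Y n0] coord_torus_rev[OF X n0]
      by (simp add: algebra_simps)
  qed
  show "let x = coord n X; y = coord n Y; x' = coord n X'; y' = coord n Y'; \<kappa> = kappa n x y
       in \<forall>j \<in> {1..int n}. \<kappa> j \<noteq> 0 \<and> \<kappa> (j + 1) \<noteq> 0 \<and>
            y' j = y j * (\<kappa> (j + 1) / \<kappa> j) \<and> x' j = x j * (\<kappa> j / \<kappa> (j + 1))"
    unfolding Let_def
  proof (intro ballI conjI)
    fix j assume j: "j \<in> {1..int n}"
    show "kap n X Y j \<noteq> 0" using k j by blast
    show "kap n X Y (j + 1) \<noteq> 0" using j by (intro kap_nonzero_upto[OF k _ n0]) simp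
    show "coord n Y' j = coord n Y j * (kap n X Y (j + 1) / kap n X Y j)"
      unfolding Y' by (rule coord_swap_first[OF Y k j])
    show "coord n X' j = coord n X j * (kap n X Y j / kap n X Y (j + 1))" by (rule x'[OF j])
  qed
qed

end
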